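(* Let $W_0\in\mathfrak{su}(N)$ and $1\le r\le N$, with $\sigma_r(W_0)>\sigma_{r+1}(W_0)$ if $r<N$. For $t\in(0,T]$ let $W(t)$ be the solution of $\dot W+[P(W),W]_N=0$ with initial condition $W_0$, let $Y(t)$ be the solution of $\dot Y+[P(Y),Y]_N=0$ with initial condition $Y_0=\Pi_r(W_0)$, and let $\Pi_r(W(t))$ be the best rank-$r$ approximation of $W(t)$. Then, for every $t\in(0,T]$, $$\|Y(t)-\Pi_r(W(t))\|_F\le\frac{\|\Pi_r(W_0)\|_F}{\hbar_NK}\,(e^{Kt}-1)\sqrt{\sum_{i=r+1}^N\sigma_i^2(W_0)},$$ where $K>0$ is a Lipschitz constant, in the Frobenius norm, of $X_H(A)=[A,P(A)]_N$ on the co-adjoint orbit $\mathcal{O}_{\mathrm{U}(N)}(Y_0)=\{RY_0R^*:R\in \mathrm{U}(N)\}$.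
   Context: Let $N\ge 2$, $\hbar_N=2/\sqrt{N^2-1}$ and $[A,B]_N=\hbar_N^{-1}(AB-BA)$. $\mathfrak{u}(N)$ denotes the skew-Hermitian $N\times N$ matrices and $\mathfrak{su}(N)$ the traceless ones; $\|\cdot\|_F$ is the Frobenius norm. Put $s=(N-1)/2$ and, for $0\le\ell\le N-1$, $-\ell\le m\le\ell$, let $T^N_{\ell,m}\in\mathbb{C}^{N\times N}$ (rows and columns indexed by $m_1,m_2\in\{-s,-s+1,\dots,s\}$) be $$(T^N_{\ell,m})_{m_1,m_2}=\sqrt{\tfrac{N}{4\pi}}\,(-1)^{s-m_1}\sqrt{2\ell+1}\begin{pmatrix}s&\ell&s\\-m_1&m&m_2\end{pmatrix}$$ (Wigner 3j-symbol). These form a basis of $\mathbb{C}^{N\times N}$, orthonormal for $\frac{4\pi}{N}\mathrm{Tr}(A^*B)$. The discrete Laplacian $\Delta_N$ is the linear map with $\Delta_NT^N_{\ell,m}=-\ell(\ell+1)T^N_{\ell,m}$; it preserves $\mathfrak{u}(N)$ and its kernel consists of multiples of the identity. $\Delta_N^{-1}$ is its inverse on traceless matrices, extended linearly by $\Delta_N^{-1}I=0$, and $P(X)=\Delta_N^{-1}X$. $\sigma_1(W)\ge\dots\ge\sigma_N(W)$ are the singular values of $W$, and $\Pi_r(W)$ denotes the best rank-$r$ approximation of $W$ in the Frobenius norm (truncated SVD). *)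

theory Defs
  imports "HOL-Analysis.Analysis"
begin

text \<open>
  The \<open>N \<times> N\<close> complex matrices are \<open>'n cmat\<close> with \<open>N = CARD('n)\<close>; the norm that the
  library puts on this type is the Frobenius norm.  The index type is linearly ordered, so that
  its elements can be identified, in increasing order, with \<open>-s, -s + 1, \<dots>, s\<close>,
  \<open>s = (N - 1) / 2\<close>, and with \<open>1, \<dots>, N\<close>.
\<close>

type_synonym 'n cmat = "((complex, 'n) vec, 'n) vec"

definition position :: "'n::{finite,linorder} \<Rightarrow> nat" where
  "position i = card {j. j \<le> i}"

definition hermitian_adjoint :: "('n::finite) cmat \<Rightarrow> 'n cmat" where
  "hermitian_adjoint A = (\<chi> i j. cnj (A $ j $ i))"

definition unitary_group :: "('n::finite) cmat set" where
  "unitary_group =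
     {R. hermitian_adjoint R ** R = mat 1 \<and> R ** hermitian_adjoint R = mat 1}"

definition skew_hermitian :: "('n::finite) cmat set" where
  "skew_hermitian = {A. hermitian_adjoint A = - A}"

definition special_skew_hermitian :: "('n::finite) cmat set" where
  "special_skew_hermitian = {A \<in> skew_hermitian. trace A = 0}"

definition coadjoint_orbit :: "('n::finite) cmat \<Rightarrow> 'n cmat set" where
  "coadjoint_orbit A = (\<lambda>R. R ** A ** hermitian_adjoint R) ` unitary_group"

definition hbar :: "nat \<Rightarrow> real" where
  "hbar N = 2 / sqrt ((real N)\<^sup>2 - 1)"

definition bracket :: "('n::finite) cmat \<Rightarrow> 'n cmat \<Rightarrow> 'n cmat" where
  "bracket A B = inverse (hbar CARD('n)) *\<^sub>R (A ** B - B ** A)"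


subsection \<open>Wigner 3j-symbols and the discrete Laplacian\<close>

text \<open>
  Racah's formula, with the Condon--Shortley phase convention.  The side conditions are the
  usual selection rules; they make every argument of \<open>fact_of\<close>, and the exponent of \<open>-1\<close>,
  an integer.  The sum runs over those \<open>k\<close> for which all factorials have nonnegative argument.
\<close>

definition fact_of :: "real \<Rightarrow> real" where
  "fact_of x = fact (nat \<lfloor>x\<rfloor>)"

definition wigner_3j :: "real \<Rightarrow> real \<Rightarrow> real \<Rightarrow> real \<Rightarrow> real \<Rightarrow> real \<Rightarrow> real" where
  "wigner_3j j1 j2 j3 m1 m2 m3 =
     (if m1 + m2 + m3 = 0 \<and>
         (\<forall>(j, m) \<in> {(j1, m1), (j2, m2), (j3, m3)}. j - m \<in> \<int> \<and> j + m \<in> \<int> \<and> \<bar>m\<bar> \<le> j) \<and>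
         \<bar>j1 - j2\<bar> \<le> j3 \<and> j3 \<le> j1 + j2
      then
        (-1) powi \<lfloor>j1 - j2 - m3\<rfloor>
        * sqrt (fact_of (j1 + j2 - j3) * fact_of (j1 - j2 + j3) * fact_of (- j1 + j2 + j3)
                / fact_of (j1 + j2 + j3 + 1))
        * sqrt (fact_of (j1 - m1) * fact_of (j1 + m1) * fact_of (j2 - m2) * fact_of (j2 + m2)
                * fact_of (j3 - m3) * fact_of (j3 + m3))
        * (\<Sum>k \<in> {k::nat. real k \<le> j1 + j2 - j3 \<and> real k \<le> j1 - m1 \<and> real k \<le> j2 + m2 \<and>
                        0 \<le> j3 - j2 + m1 + real k \<and> 0 \<le> j3 - j1 - m2 + real k}.
             (-1) ^ k
             / (fact k * fact_of (j1 + j2 - j3 - real k) * fact_of (j1 - m1 - real k)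
                * fact_of (j2 + m2 - real k) * fact_of (j3 - j2 + m1 + real k)
                * fact_of (j3 - j1 - m2 + real k)))
      else 0)"

definition spin :: "'n::finite itself \<Rightarrow> real" where
  "spin _ = (real CARD('n) - 1) / 2"

definition magnetic_number :: "'n::{finite,linorder} \<Rightarrow> real" where
  "magnetic_number i = real (position i) - 1 - spin TYPE('n)"

definition T_matrix :: "nat \<Rightarrow> int \<Rightarrow> ('n::{finite,linorder}) cmat" where
  "T_matrix l m =
     (let s = spin TYPE('n) in
      \<chi> i j. complex_of_real
        (sqrt (real CARD('n) / (4 * pi)) * (-1) powi \<lfloor>s - magnetic_number i\<rfloor>
         * sqrt (2 * real l + 1)
         * wigner_3j s (real l) s (- magnetic_number i) (of_int m) (magnetic_number j)))"

text \<open>Multiplication by complex scalars; the library only provides \<open>*\<^sub>R\<close> at this type.\<close>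

definition cscale :: "complex \<Rightarrow> ('n::finite) cmat \<Rightarrow> 'n cmat" where
  "cscale c A = (\<chi> i j. c * A $ i $ j)"

definition discrete_laplacian :: "('n::{finite,linorder}) cmat \<Rightarrow> 'n cmat" where
  "discrete_laplacian =
     (THE D. Vector_Spaces.linear cscale cscale D \<and>
        (\<forall>l < CARD('n). \<forall>m \<in> {- int l..int l}.
           D (T_matrix l m) = cscale (- of_nat (l * (l + 1))) (T_matrix l m)))"

text \<open>
  The inverse of the Laplacian on the traceless matrices, extended linearly by \<open>0\<close> on the
  identity: \<open>(trace X / N) I\<close> is the component of \<open>X\<close> along the identity.
\<close>

definition inverse_laplacian :: "('n::{finite,linorder}) cmat \<Rightarrow> 'n cmat" where
  "inverse_laplacian X =
     inv_into {A. trace A = 0} discrete_laplacian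
       (X - cscale (trace X / of_nat CARD('n)) (mat 1))"

definition hamiltonian_field :: "('n::{finite,linorder}) cmat \<Rightarrow> 'n cmat" where
  "hamiltonian_field A = bracket A (inverse_laplacian A)"

text \<open>\<open>W\<close> solves \<open>W' + [P(W), W]\<^sub>N = 0\<close>, \<open>W(0) = W0\<close>, on \<open>[0, T]\<close>, with one-sided
  derivatives at the end points.\<close>

definition euler_zeitlin_solution ::
  "real \<Rightarrow> ('n::{finite,linorder}) cmat \<Rightarrow> (real \<Rightarrow> 'n cmat) \<Rightarrow> bool" where
  "euler_zeitlin_solution T W0 W \<longleftrightarrow>
     W 0 = W0 \<and>
     (\<forall>t\<in>{0..T}. \<exists>D. (W has_vector_derivative D) (at t within {0..T}) \<and>
                     D + bracket (inverse_laplacian (W t)) (W t) = 0)"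


subsection \<open>Singular values and best low-rank approximation\<close>

definition diagonal_matrix :: "(nat \<Rightarrow> real) \<Rightarrow> ('n::{finite,linorder}) cmat" where
  "diagonal_matrix \<sigma> = (\<chi> i j. if i = j then complex_of_real (\<sigma> (position i)) else 0)"

text \<open>
  \<open>singular_value A i\<close> is \<open>\<sigma>\<^sub>i(A)\<close> for \<open>1 \<le> i \<le> N\<close>, the diagonal of a singular value
  decomposition; it is set to \<open>0\<close> for other \<open>i\<close> to make the sequence unique.
\<close>

definition singular_value :: "('n::{finite,linorder}) cmat \<Rightarrow> nat \<Rightarrow> real" where
  "singular_value A =
     (THE \<sigma>. antimono_on {1..CARD('n)} \<sigma> \<and> (\<forall>i. 0 \<le> \<sigma> i) \<and>
        (\<forall>i. i \<notin> {1..CARD('n)} \<longrightarrow> \<sigma> i = 0) \<and>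
        (\<exists>U\<in>unitary_group. \<exists>V\<in>unitary_group.
           A = U ** diagonal_matrix \<sigma> ** hermitian_adjoint V))"

text \<open>
  A minimiser of the Frobenius distance to \<open>A\<close>; by Eckart--Young it is the truncated singular
  value decomposition, and it is unique when \<open>\<sigma>\<^sub>r(A) > \<sigma>\<^bsub>r+1\<^esub>(A)\<close> or \<open>r = N\<close>.
\<close>

definition best_rank_approx :: "nat \<Rightarrow> ('n::finite) cmat \<Rightarrow> 'n cmat" where
  "best_rank_approx r A = arg_min_on (\<lambda>B. norm (A - B)) {B. rank B \<le> r}"

end

theory Submission
  imports Defs
begin

text \<open>
  The solution \<open>W\<close> moves by unitary conjugation, \<open>W(t) = R(t) W\<^sub>0 R(t)\<^sup>*\<close>, where \<open>R\<close> solves a linear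
  equation with generator \<open>- \<hbar>\<^sup>-\<^sup>1 P(W)\<close> (\<open>euler_zeitlin_unitary_conjugation\<close>).  The singular
  values are therefore constant in time, the gap after \<open>\<sigma>\<^sub>r\<close> persists, and the best approximation
  \<open>Z(t) = \<Pi>\<^sub>r(W(t))\<close>, being unique by the theorem of Eckart and Young, is conjugated by the same
  \<open>R(t)\<close>.  Hence \<open>Z' = [Z, P(W)]\<^sub>N\<close>, while \<open>Y' = [Y, P(Y)]\<^sub>N = X\<^sub>H(Y)\<close>, and \<open>Y\<close> and \<open>Z\<close> start at
  the same point and stay in its coadjoint orbit.  From
  \<open>(Y - Z)' = (X\<^sub>H(Y) - X\<^sub>H(Z)) - [Z, P(W - Z)]\<^sub>N\<close>
  and the Lipschitz bound, Gronwall's inequality (\<open>gronwall_norm\<close>) leaves only the last term to be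
  estimated.  Its norm is at most \<open>\<hbar>\<^sup>-\<^sup>1 \<cdot> 2 \<parallel>Z\<parallel> \<parallel>P(W - Z)\<parallel>\<close>, where \<open>\<parallel>Z\<parallel> = \<parallel>\<Pi>\<^sub>r(W\<^sub>0)\<parallel>\<close> and
  \<open>\<parallel>W - Z\<parallel>\<^sup>2 = \<Sum>\<^bsub>i>r\<^esub> \<sigma>\<^sub>i\<^sup>2\<close> are constant, and the eigenvalues \<open>- l (l + 1)\<close> of the Laplacian on
  traceless matrices have modulus at least \<open>2\<close>, so that \<open>\<parallel>P(X)\<parallel> \<le> \<parallel>X\<parallel> / 2\<close> absorbs the \<open>2\<close>.

  Two bodies of theory carry this argument.  The first is linear algebra over the complex numbers:
  singular value decompositions exist (\<open>svd_exists\<close>, by maximising a trace over pairs of unitary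
  matrices), and truncation is the only best approximation of given rank if there is a gap
  (\<open>eckart_young\<close>), which also shows that the singular values are well defined.

  The second concerns the Laplacian, which is given only through its values on matrices built from
  3j-symbols.  Racah's sum satisfies a three-term recurrence (\<open>racah_sum_recurrence\<close>), by which
  these matrices are eigenvectors of an explicit operator, the Casimir operator of the adjoint
  action of \<open>su(2)\<close> (\<open>casimir_T_matrix\<close>).  That operator is symmetric and commutes with the adjoint.
  So the matrices are orthogonal for equal \<open>m\<close>, as they are for different \<open>m\<close> by their disjoint
  supports; by counting they form a basis (\<open>spherical_expansion\<close>), the Laplacian
  is the Casimir operator (\<open>discrete_laplacian_eq_casimir\<close>), and \<open>P\<close> commutes with the adjoint and
  obeys the norm bound above (\<open>norm_inverse_laplacian_le\<close>).
\<close>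


section \<open>Matrix algebra with the Frobenius norm\<close>

abbreviation adj :: "('n::finite) cmat \<Rightarrow> 'n cmat" where
  "adj \<equiv> hermitian_adjoint"

lemma adj_nth [simp]: "adj A $ i $ j = cnj (A $ j $ i)"
  by (simp add: hermitian_adjoint_def)

lemma adj_adj [simp]: "adj (adj A) = A"
  by (simp add: vec_eq_iff)

lemma adj_mult: "adj (A ** B) = adj B ** adj A"
  by (simp add: vec_eq_iff matrix_matrix_mult_def mult.commute)

lemma adj_add [simp]: "adj (A + B) = adj A + adj B"
  by (simp add: vec_eq_iff)

lemma adj_diff [simp]: "adj (A - B) = adj A - adj B"
  by (simp add: vec_eq_iff)

lemma adj_minus [simp]: "adj (- A) = - adj A"
  by (simp add: vec_eq_iff)

lemma adj_scaleR [simp]: "adj (c *\<^sub>R A) = c *\<^sub>R adj A"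
  by (simp add: vec_eq_iff)

lemma adj_mat_1 [simp]: "adj (mat 1) = mat 1"
  by (simp add: vec_eq_iff mat_def)

lemma matrix_diff_ldistrib: "A ** (B - C) = A ** B - A ** (C :: ('n::finite) cmat)"
  by (simp add: vec_eq_iff matrix_matrix_mult_def algebra_simps sum_subtractf)

lemma matrix_diff_rdistrib: "(B - C) ** A = B ** A - C ** (A :: ('n::finite) cmat)"
  by (simp add: vec_eq_iff matrix_matrix_mult_def algebra_simps sum_subtractf)

lemma matrix_minus_left: "(- A) ** B = - (A ** (B :: ('n::finite) cmat))"
  by (simp add: vec_eq_iff matrix_matrix_mult_def sum_negf)

lemma matrix_minus_right: "A ** (- B) = - (A ** (B :: ('n::finite) cmat))"
  by (simp add: vec_eq_iff matrix_matrix_mult_def sum_negf)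

lemma matrix_scaleR_left: "(c *\<^sub>R A) ** B = c *\<^sub>R (A ** (B :: ('n::finite) cmat))"
  by (simp add: vec_eq_iff matrix_matrix_mult_def scaleR_sum_right)

lemma matrix_scaleR_right: "A ** (c *\<^sub>R B) = c *\<^sub>R (A ** (B :: ('n::finite) cmat))"
  by (simp add: vec_eq_iff matrix_matrix_mult_def scaleR_sum_right)

lemma matrix_add_rdistrib_cmat: "(B + C) ** A = B ** A + C ** (A :: ('n::finite) cmat)"
  by (simp add: vec_eq_iff matrix_matrix_mult_def algebra_simps sum.distrib)

lemmas matrix_ring_simps =
  matrix_diff_ldistrib matrix_diff_rdistrib matrix_add_ldistrib matrix_add_rdistrib_cmat
  matrix_minus_left matrix_minus_right matrix_scaleR_left matrix_scaleR_right

lemma matrix_mult_0_right [simp]: "(A :: ('n::finite) cmat) ** 0 = 0"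
  by (simp add: vec_eq_iff matrix_matrix_mult_def)

lemma inner_cmat: "inner A B = (\<Sum>i\<in>UNIV. \<Sum>j\<in>UNIV. Re (cnj (A $ i $ j) * B $ i $ j))"
  for A B :: "('n::finite) cmat"
  by (simp add: inner_vec_def inner_complex_def)

lemma norm_cmat_squared: "(norm A)\<^sup>2 = (\<Sum>i\<in>UNIV. \<Sum>j\<in>UNIV. (cmod (A $ i $ j))\<^sup>2)"
  for A :: "('n::finite) cmat"
  by (simp add: power2_norm_eq_inner[of A] inner_cmat cmod_power2) (simp add: power2_eq_square)

lemma inner_eq_trace: "inner A B = Re (trace (adj A ** B))"
  for A B :: "('n::finite) cmat"
  unfolding inner_cmat trace_def matrix_matrix_mult_def
  by (subst sum.swap) simp

lemma inner_mult_left: "inner (A ** B) C = inner B (adj A ** C)"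
  for A B C :: "('n::finite) cmat"
  by (simp add: inner_eq_trace adj_mult matrix_mul_assoc)

lemma inner_mult_right: "inner (B ** A) C = inner B (C ** adj A)"
  for A B C :: "('n::finite) cmat"
proof -
  have "trace (adj (B ** A) ** C) = trace (adj A ** (adj B ** C))"
    by (simp add: adj_mult matrix_mul_assoc)
  also have "\<dots> = trace ((adj B ** C) ** adj A)" by (rule trace_mul_sym)
  finally show ?thesis by (simp add: inner_eq_trace matrix_mul_assoc)
qed

lemma norm_adj [simp]: "norm (adj A) = norm A"
proof -
  have "(norm (adj A))\<^sup>2 = (norm A)\<^sup>2"
    unfolding norm_cmat_squared by (subst sum.swap) simp
  then show ?thesis by simp
qed

text \<open>Cauchy--Schwarz applied to every entry of the product.\<close>

lemma norm_matrix_mult_le: "norm (A ** B) \<le> norm A * norm B"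
  for A B :: "('n::finite) cmat"
proof -
  have entry: "(cmod ((A ** B) $ i $ j))\<^sup>2
      \<le> (\<Sum>k\<in>UNIV. (cmod (A $ i $ k))\<^sup>2) * (\<Sum>k\<in>UNIV. (cmod (B $ k $ j))\<^sup>2)" for i j
  proof -
    have "cmod ((A ** B) $ i $ j) \<le> (\<Sum>k\<in>UNIV. cmod (A $ i $ k) * cmod (B $ k $ j))"
      unfolding matrix_matrix_mult_def by (simp add: sum_norm_le norm_mult)
    then have "(cmod ((A ** B) $ i $ j))\<^sup>2
        \<le> (\<Sum>k\<in>UNIV. cmod (A $ i $ k) * cmod (B $ k $ j))\<^sup>2"
      by (simp add: power_mono)
    also have "\<dots> \<le> (\<Sum>k\<in>UNIV. (cmod (A $ i $ k))\<^sup>2) * (\<Sum>k\<in>UNIV. (cmod (B $ k $ j))\<^sup>2)"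
      by (rule Cauchy_Schwarz_ineq_sum)
    finally show ?thesis .
  qed
  have "(norm (A ** B))\<^sup>2
      \<le> (\<Sum>i\<in>UNIV. \<Sum>j\<in>UNIV.
          (\<Sum>k\<in>UNIV. (cmod (A $ i $ k))\<^sup>2) * (\<Sum>k\<in>UNIV. (cmod (B $ k $ j))\<^sup>2))"
    unfolding norm_cmat_squared[of "A ** B"] by (intro sum_mono entry)
  also have "\<dots> = (\<Sum>i\<in>UNIV. \<Sum>k\<in>UNIV. (cmod (A $ i $ k))\<^sup>2)
      * (\<Sum>j\<in>UNIV. \<Sum>k\<in>UNIV. (cmod (B $ k $ j))\<^sup>2)"
    by (simp add: sum_product)
  also have "\<dots> = (norm A * norm B)\<^sup>2"
    unfolding power_mult_distrib norm_cmat_squared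
    by (subst sum.swap[of "\<lambda>j k. (cmod (B $ k $ j))\<^sup>2"]) simp
  finally show ?thesis by (rule power2_le_imp_le) simp
qed

lemma bounded_bilinear_matrix_mult:
  "bounded_bilinear ((**) :: ('n::finite) cmat \<Rightarrow> 'n cmat \<Rightarrow> 'n cmat)"
proof
  show "\<exists>K. \<forall>(a :: 'n cmat) (b :: 'n cmat). norm (a ** b) \<le> norm a * norm b * K"
    by (rule exI[of _ 1]) (simp add: norm_matrix_mult_le)
qed (simp_all add: matrix_ring_simps)

lemmas matrix_mult_has_vector_derivative =
  bounded_bilinear.has_vector_derivative[OF bounded_bilinear_matrix_mult]

lemmas continuous_on_matrix_mult [continuous_intros] =
  bounded_bilinear.continuous_on[OF bounded_bilinear_matrix_mult]

lemma bounded_linear_adj: "bounded_linear (adj :: ('n::finite) cmat \<Rightarrow> 'n cmat)"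
  by (rule bounded_linear_intro[of _ 1]) simp_all

lemmas continuous_on_adj [continuous_intros] =
  bounded_linear.continuous_on[OF bounded_linear_adj]

lemmas adj_has_vector_derivative = bounded_linear.has_vector_derivative[OF bounded_linear_adj]

section \<open>Unitary matrices\<close>

lemma unitaryD:
  assumes "U \<in> unitary_group"
  shows "adj U ** U = mat 1" "U ** adj U = mat 1"
  using assms by (auto simp: unitary_group_def)

lemma unitary_cancel:
  fixes U A :: "('n::finite) cmat"
  assumes "U \<in> unitary_group"
  shows "adj U ** (U ** A) = A" "U ** (adj U ** A) = A"
    "A ** U ** adj U = A" "A ** adj U ** U = A"
proof -
  show "adj U ** (U ** A) = A" "U ** (adj U ** A) = A"
    by (simp_all add: matrix_mul_assoc unitaryD[OF assms])
  show "A ** U ** adj U = A" "A ** adj U ** U = A"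
    by (simp_all add: matrix_mul_assoc[symmetric] unitaryD[OF assms])
qed

lemma unitary_mat_1: "mat 1 \<in> unitary_group"
  by (simp add: unitary_group_def)

lemma unitary_mult: "U \<in> unitary_group \<Longrightarrow> V \<in> unitary_group \<Longrightarrow> U ** V \<in> unitary_group"
  by (auto simp: unitary_group_def adj_mult) (metis matrix_mul_assoc matrix_mul_rid)+

lemma unitary_adj: "U \<in> unitary_group \<Longrightarrow> adj U \<in> unitary_group"
  by (simp add: unitary_group_def)

lemma unitary_minus: "U \<in> unitary_group \<Longrightarrow> - U \<in> unitary_group"
  by (simp add: unitary_group_def matrix_ring_simps)

lemma norm_unitary_left [simp]: "U \<in> unitary_group \<Longrightarrow> norm (U ** A) = norm A" for A :: "('n::finite) cmat"
  by (simp only: norm_eq_sqrt_inner inner_mult_left unitary_cancel)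

lemma norm_unitary_right [simp]: "U \<in> unitary_group \<Longrightarrow> norm (A ** U) = norm A" for A :: "('n::finite) cmat"
  by (simp only: norm_eq_sqrt_inner inner_mult_right unitary_cancel)

lemma norm_unitary_adj_right [simp]: "U \<in> unitary_group \<Longrightarrow> norm (A ** adj U) = norm A" for A :: "('n::finite) cmat"
  by (simp add: unitary_adj)

lemma compact_unitary_group: "compact (unitary_group :: ('n::finite) cmat set)"
proof -
  have "(norm U)\<^sup>2 = real CARD('n)" if "U \<in> unitary_group" for U :: "'n cmat"
    by (simp add: power2_norm_eq_inner inner_eq_trace unitaryD[OF that] trace_I)
  then have "bounded (unitary_group :: 'n cmat set)"
    unfolding bounded_iff
    by (intro exI[of _ "sqrt (real CARD('n))"]) (auto intro: real_le_rsqrt)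
  moreover have "closed ((unitary_group) :: 'n cmat set)"
    unfolding unitary_group_def
    by (intro closed_Collect_conj closed_Collect_eq continuous_intros)
  ultimately show ?thesis by (simp add: compact_eq_bounded_closed)
qed


section \<open>Diagonal matrices and positions\<close>

lemma position_less_iff: "position i < position j \<longleftrightarrow> i < j"
  for i j :: "'n::{finite,linorder}"
proof -
  have mono: "position a < position b" if "a < b" for a b :: 'n
    unfolding position_def using that by (intro psubset_card_mono psubsetI) (auto simp: set_eq_iff not_le[symmetric])
  show ?thesis using mono[of i j] mono[of j i] by (metis less_asym linorder_neqE)
qed

lemma position_inj: "position i = position j \<longleftrightarrow> i = j"
  for i j :: "'n::{finite,linorder}"
  by (metis less_irrefl linorder_neqE position_less_iff)

lemma position_range: "position i \<in> {1..CARD('n)}" for i :: "'n::{finite,linorder}"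
proof -
  have "card {j. j \<le> i} > 0" by (auto simp: card_gt_0_iff)
  moreover have "card {j. j \<le> i} \<le> CARD('n)" by (rule card_mono) auto
  ultimately show ?thesis by (simp add: position_def Suc_le_eq)
qed

lemma bij_betw_position:
  "bij_betw (position :: 'n::{finite,linorder} \<Rightarrow> nat) UNIV {1..CARD('n)}"
proof -
  have inj: "inj (position :: 'n \<Rightarrow> nat)" by (auto simp: inj_on_def position_inj)
  have "range (position :: 'n \<Rightarrow> nat) = {1..CARD('n)}"
  proof (rule card_subset_eq)
    show "range (position :: 'n \<Rightarrow> nat) \<subseteq> {1..CARD('n)}" using position_range by blast
    show "card (range (position :: 'n \<Rightarrow> nat)) = card {1..CARD('n)}"
      by (simp add: card_image[OF inj])
  qed simp
  with inj show ?thesis by (simp add: bij_betw_def)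
qed

lemma sum_position: "(\<Sum>i\<in>UNIV. f (position (i :: 'n::{finite,linorder}))) = (\<Sum>k=1..CARD('n). f k)"
  by (rule sum.reindex_bij_betw[OF bij_betw_position])

lemma diagonal_matrix_nth [simp]:
  "diagonal_matrix \<sigma> $ i $ j = (if i = j then of_real (\<sigma> (position i)) else 0)"
  by (simp add: diagonal_matrix_def)

lemma adj_diagonal [simp]: "adj (diagonal_matrix \<sigma>) = diagonal_matrix \<sigma>"
  by (simp add: vec_eq_iff)

lemma diagonal_mult_nth [simp]:
  "(diagonal_matrix \<sigma> ** A) $ i $ j = of_real (\<sigma> (position i)) * A $ i $ j"
  by (simp add: matrix_matrix_mult_def if_distrib[where f="\<lambda>x. x * _"] cong: if_cong)

lemma mult_diagonal_nth [simp]: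
  "(A ** diagonal_matrix \<sigma>) $ i $ j = A $ i $ j * of_real (\<sigma> (position j))"
  by (simp add: matrix_matrix_mult_def if_distrib[where f="\<lambda>x. _ * x"] cong: if_cong)

lemma norm_diagonal_squared:
  "(norm (diagonal_matrix \<sigma> :: ('n::{finite,linorder}) cmat))\<^sup>2 = (\<Sum>k=1..CARD('n). (\<sigma> k)\<^sup>2)"
proof -
  have "(norm (diagonal_matrix \<sigma> :: 'n cmat))\<^sup>2
      = (\<Sum>i\<in>UNIV. \<Sum>j\<in>UNIV. if i = j then (\<sigma> (position (i::'n)))\<^sup>2 else 0)"
    unfolding norm_cmat_squared by (intro sum.cong refl) simp
  also have "\<dots> = (\<Sum>i\<in>UNIV. (\<sigma> (position (i::'n)))\<^sup>2)" by simp
  finally show ?thesis by (simp add: sum_position[of "\<lambda>k. (\<sigma> k)\<^sup>2"])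
qed

section \<open>Existence of singular value decompositions\<close>

text \<open>
  Rank-one perturbations \<open>I + (u - 1) v v\<^sup>*\<close> of the identity stay unitary; they turn a
  maximality condition over the unitary group into positivity of a quadratic form.
\<close>

lemma rank_one_unitary:
  fixes v :: "'n::finite \<Rightarrow> complex"
  assumes u: "cmod u = 1" and v: "(\<Sum>k\<in>UNIV. (cmod (v k))\<^sup>2) = 1"
  shows "(\<chi> i j. (if i = j then 1 else 0) + (u - 1) * v i * cnj (v j)) \<in> unitary_group"
proof -
  have key: "adj (\<chi> i j. (if i = j then 1 else 0) + (u - 1) * v i * cnj (v j))
      ** (\<chi> i j. (if i = j then 1 else 0) + (u - 1) * v i * cnj (v j)) = mat 1"
    if u: "cmod u = 1" for u
  proof -
    have uu: "cnj u * u = 1"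
      using u by (simp add: complex_norm_square[symmetric] mult.commute)
    have vv: "(\<Sum>k\<in>UNIV. cnj (v k) * v k) = 1"
    proof -
      have "(\<Sum>k\<in>UNIV. cnj (v k) * v k) = of_real (\<Sum>k\<in>UNIV. (cmod (v k))\<^sup>2)"
        unfolding of_real_sum complex_norm_square by (simp add: mult.commute)
      then show ?thesis using v by simp
    qed
    have "(\<Sum>k\<in>UNIV. ((if k = i then 1 else 0) + (cnj u - 1) * cnj (v k) * v i)
          * ((if k = j then 1 else 0) + (u - 1) * v k * cnj (v j)))
        = (if i = j then 1 else 0)" for i j
    proof -
      have "(\<Sum>k\<in>UNIV. ((if k = i then 1 else 0) + (cnj u - 1) * cnj (v k) * v i)
          * ((if k = j then 1 else 0) + (u - 1) * v k * cnj (v j)))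
        = (\<Sum>k\<in>UNIV. (if k = i then (if i = j then 1 else 0) else 0)
            + (if k = i then (u - 1) * v i * cnj (v j) else 0)
            + (if k = j then (cnj u - 1) * cnj (v j) * v i else 0)
            + ((cnj u - 1) * (u - 1) * v i * cnj (v j)) * (cnj (v k) * v k))"
        by (intro sum.cong refl) (auto simp: algebra_simps)
      also have "\<dots> = (if i = j then 1 else 0) + (u - 1) * v i * cnj (v j)
            + (cnj u - 1) * cnj (v j) * v i + (cnj u - 1) * (u - 1) * v i * cnj (v j)"
        by (simp only: sum.distrib sum_distrib_left[symmetric] vv) simp
      also have "\<dots> = (if i = j then 1 else 0) + (cnj u * u - 1) * v i * cnj (v j)"
        by (simp add: algebra_simps)
      finally show ?thesis using uu by simp
    qed
    then show ?thesis
      by (simp add: vec_eq_iff matrix_matrix_mult_def mat_def if_distrib[where f=cnj] cong: if_cong)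
  qed
  have adj_eq: "adj (\<chi> i j. (if i = j then 1 else 0) + (u - 1) * v i * cnj (v j))
      = (\<chi> i j. (if i = j then 1 else 0) + (cnj u - 1) * v i * cnj (v j))" for u
    by (simp add: vec_eq_iff)
  show ?thesis
    unfolding unitary_group_def using key[OF u] key[of "cnj u"] u
    by (simp add: adj_eq)
qed

lemma sum_two:
  fixes f :: "'n::finite \<Rightarrow> 'a::comm_monoid_add"
  assumes "i \<noteq> j" "\<And>k. k \<noteq> i \<Longrightarrow> k \<noteq> j \<Longrightarrow> f k = 0"
  shows "sum f UNIV = f i + f j"
proof -
  have "sum f UNIV = sum f {i, j}" by (rule sum.mono_neutral_right) (use assms in auto)
  then show ?thesis using assms by simp
qed

text \<open>
  For \<open>R = I + (u - 1) v v\<^sup>*\<close> maximality says that \<open>Re ((u - 1) q) \<le> 0\<close>, where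
  \<open>q = v\<^sup>* C v\<close>.  Turning \<open>q\<close> onto the positive real axis by the choice of \<open>u\<close> shows that
  \<open>q\<close> is real and nonnegative.  So \<open>C\<close> is positive semidefinite, and polarisation with the
  vectors \<open>e\<^sub>i + w e\<^sub>j\<close>, for \<open>w = 1\<close> and \<open>w = \<i>\<close>, compares the entries.
\<close>

lemma hermitian_if_trace_maximal:
  fixes C :: "('n::finite) cmat"
  assumes max: "\<And>R. R \<in> unitary_group \<Longrightarrow> Re (trace (R ** C)) \<le> Re (trace C)"
  shows "C $ j $ i = cnj (C $ i $ j)" and "Re (C $ i $ i) \<ge> 0"
proof -
  have quad: "Im (\<Sum>i\<in>UNIV. \<Sum>j\<in>UNIV. v i * cnj (v j) * C $ j $ i) = 0
      \<and> Re (\<Sum>i\<in>UNIV. \<Sum>j\<in>UNIV. v i * cnj (v j) * C $ j $ i) \<ge> 0"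
    if v: "(\<Sum>k\<in>UNIV. (cmod (v k))\<^sup>2) = 1" for v :: "'n \<Rightarrow> complex"
  proof -
    define q where "q = (\<Sum>i\<in>UNIV. \<Sum>j\<in>UNIV. v i * cnj (v j) * C $ j $ i)"
    have "cmod q \<le> Re q"
    proof (cases "q = 0")
      case False
      define u where "u = cnj q / of_real (cmod q)"
      have u: "cmod u = 1" using False by (simp add: u_def norm_divide)
      define R :: "'n cmat"
        where "R = (\<chi> i j. (if i = j then 1 else 0) + (u - 1) * v i * cnj (v j))"
      have "trace (R ** C)
          = (\<Sum>i\<in>UNIV. \<Sum>j\<in>UNIV. (if i = j then C $ j $ i else 0)
                + (u - 1) * (v i * cnj (v j) * C $ j $ i))"
        unfolding trace_def R_def matrix_matrix_mult_def
        by (auto intro!: sum.cong simp: algebra_simps)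
      also have "\<dots> = trace C + (u - 1) * q"
        unfolding q_def trace_def by (simp add: sum.distrib sum_distrib_left)
      finally have "Re ((u - 1) * q) \<le> 0"
        using max[OF rank_one_unitary[OF u v]] unfolding R_def[symmetric] by simp
      moreover have "u * q = of_real (cmod q)"
        using False by (simp add: u_def mult.commute[of _ q] complex_norm_square[symmetric]
            power2_eq_square)
      ultimately show ?thesis by (simp add: left_diff_distrib)
    qed simp
    then have sq: "(cmod q)\<^sup>2 \<le> (Re q)\<^sup>2" and "Re q \<ge> 0"
      using order_trans[OF norm_ge_zero] by (auto intro: power_mono)
    moreover have "Im q = 0" using sq unfolding cmod_power2 by simp
    ultimately have "Im q = 0 \<and> Re q \<ge> 0" by simp
    then show ?thesis unfolding q_def .
  qed
  have diag: "Im (C $ i $ i) = 0 \<and> Re (C $ i $ i) \<ge> 0" for i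
  proof -
    let ?v = "\<lambda>k. if k = i then 1 else 0 :: complex"
    have "(\<Sum>k\<in>UNIV. (cmod (?v k))\<^sup>2) = 1"
      by (simp add: if_distrib[where f="\<lambda>x. (cmod x)\<^sup>2"] cong: if_cong)
    from quad[OF this] show ?thesis
      by (simp add: if_distrib[where f="\<lambda>x. x * _"] if_distrib[where f=cnj]
          if_distrib[where f="\<lambda>x. _ * x"] cong: if_cong)
  qed
  then show "Re (C $ i $ i) \<ge> 0" by blast
  show "C $ j $ i = cnj (C $ i $ j)"
  proof (cases "i = j")
    case True
    then show ?thesis using diag[of i] by (simp add: complex_eq_iff)
  next
    case False
    have two: "Im (cnj w * C $ j $ i + w * C $ i $ j) = 0" if w: "cmod w = 1" for w
    proof -
      define c :: complex where "c = of_real (1 / sqrt 2)"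
      define v where "v = (\<lambda>k. if k = i then c else if k = j then c * w else 0)"
      have c: "(cmod c)\<^sup>2 = 1/2" "c * cnj c = 1/2"
        unfolding complex_norm_square[symmetric] by (simp_all add: c_def norm_divide power_divide)
      have vi: "v i = c" "v j = c * w" "\<And>k. k \<noteq> i \<Longrightarrow> k \<noteq> j \<Longrightarrow> v k = 0"
        using False by (auto simp: v_def)
      have "(\<Sum>k\<in>UNIV. (cmod (v k))\<^sup>2) = 1"
        by (subst sum_two[OF False]) (use vi c w in \<open>auto simp: norm_mult\<close>)
      from quad[OF this]
      have "Im (\<Sum>a\<in>UNIV. \<Sum>b\<in>UNIV. v a * cnj (v b) * C $ b $ a) = 0" ..
      moreover have "(\<Sum>a\<in>UNIV. \<Sum>b\<in>UNIV. v a * cnj (v b) * C $ b $ a)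
          = (c * cnj c) * (C $ i $ i + (w * cnj w) * C $ j $ j + (cnj w * C $ j $ i + w * C $ i $ j))"
        by (subst sum_two[OF False], use vi in simp)
           (subst (1 2) sum_two[OF False], use vi in \<open>auto simp: algebra_simps\<close>)
      ultimately show ?thesis
        using diag[of i] diag[of j] w
        by (simp add: c complex_norm_square[symmetric])
    qed
    show ?thesis using two[of 1] two[of \<i>] by (simp add: complex_eq_iff)
  qed
qed

text \<open>
  The values outside \<open>1, \<dots>, N\<close> are fixed to \<open>0\<close>, so that \<open>\<sigma>\<close> is determined by \<open>A\<close> as a
  function, and so that \<open>\<sigma> (N + 1) = 0\<close> is a lower bound for all of them.
\<close>

definition is_svd :: "('n::{finite,linorder}) cmat \<Rightarrow> 'n cmat \<Rightarrow> (nat \<Rightarrow> real) \<Rightarrow> 'n cmat \<Rightarrow> bool" where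
  "is_svd A U \<sigma> V \<longleftrightarrow>
     U \<in> unitary_group \<and> V \<in> unitary_group \<and>
     antimono_on {1..CARD('n)} \<sigma> \<and> (\<forall>i. 0 \<le> \<sigma> i) \<and> (\<forall>i. i \<notin> {1..CARD('n)} \<longrightarrow> \<sigma> i = 0) \<and>
     A = U ** diagonal_matrix \<sigma> ** adj V"

text \<open>
  Fix a diagonal matrix \<open>D\<close> with positive, strictly decreasing entries \<open>d\<^sub>i\<close> and maximise
  \<open>Re (trace (D U\<^sup>* A V))\<close> over the compact set of pairs of unitary matrices.  At a maximum put
  \<open>M = U\<^sup>* A V\<close>.  Varying \<open>U\<close> and \<open>V\<close> separately makes both \<open>M D\<close> and \<open>D M\<close> Hermitian with
  nonnegative diagonal, hence \<open>d\<^sub>i\<^sup>2 M\<^sub>j\<^sub>i = d\<^sub>j\<^sup>2 M\<^sub>j\<^sub>i\<close> and \<open>M\<close> is diagonal and nonnegative.  Its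
  diagonal is sorted because swapping two basis vectors cannot increase the trace.
\<close>

theorem svd_exists:
  fixes A :: "('n::{finite,linorder}) cmat"
  obtains U \<sigma> V where "is_svd A U \<sigma> V"
proof -
  define \<delta> :: "nat \<Rightarrow> real" where "\<delta> k = real CARD('n) + 1 - real k" for k
  define D :: "'n cmat" where "D = diagonal_matrix \<delta>"
  define d where "d i = \<delta> (position i)" for i :: 'n
  have d_pos: "d i > 0" for i using position_range[of i] by (simp add: d_def \<delta>_def)
  have d_inj: "d i = d j \<longleftrightarrow> i = j" for i j by (simp add: d_def \<delta>_def position_inj)
  define f where "f = (\<lambda>p. inner (fst p ** D) (A ** snd p))"
  have "continuous_on (unitary_group \<times> unitary_group) f"
    unfolding f_def by (intro continuous_intros)
  moreover have "compact (unitary_group \<times> unitary_group :: ('n cmat \<times> 'n cmat) set)"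
    by (intro compact_Times compact_unitary_group)
  moreover have "unitary_group \<times> unitary_group \<noteq> ({} :: ('n cmat \<times> 'n cmat) set)"
    using unitary_mat_1 by blast
  ultimately obtain p where "p \<in> unitary_group \<times> unitary_group"
      and p_max: "\<And>q. q \<in> unitary_group \<times> unitary_group \<Longrightarrow> f q \<le> f p"
    using continuous_attains_sup[of "unitary_group \<times> unitary_group" f] by blast
  then obtain U V where U: "U \<in> unitary_group" and V: "V \<in> unitary_group" and p: "p = (U, V)"
    by blast
  define M where "M = adj U ** A ** V"
  have max: "inner (R ** D) (M ** S) \<le> inner D M"
    if "R \<in> unitary_group" "S \<in> unitary_group" for R S
  proof -
    have "f (U ** R, V ** S) = inner (U ** (R ** D)) (A ** (V ** S))"
      by (simp add: f_def matrix_mul_assoc)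
    also have "\<dots> = inner (R ** D) (M ** S)"
      unfolding inner_mult_left M_def by (simp add: matrix_mul_assoc)
    finally have *: "f (U ** R, V ** S) = inner (R ** D) (M ** S)" .
    have "f (U, V) = inner D M"
      unfolding f_def fst_conv snd_conv inner_mult_left M_def by (simp add: matrix_mul_assoc)
    with * p_max[of "(U ** R, V ** S)"] that U V show ?thesis by (simp add: p unitary_mult)
  qed
  have D_adj: "adj D = D" by (simp add: D_def)
  have left: "Re (trace (R ** (M ** D))) \<le> Re (trace (M ** D))" if "R \<in> unitary_group" for R
  proof -
    have "inner (adj R ** D) M = Re (trace (D ** (R ** M)))"
      by (simp add: inner_eq_trace adj_mult D_adj matrix_mul_assoc)
    also have "\<dots> = Re (trace (R ** (M ** D)))" by (subst trace_mul_sym) (simp add: matrix_mul_assoc)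
    finally show ?thesis
      using max[of "adj R" "mat 1"] that
      by (simp add: unitary_adj unitary_mat_1 inner_eq_trace[of D] D_adj trace_mul_sym[of D])
  qed
  have right: "Re (trace (R ** (D ** M))) \<le> Re (trace (D ** M))" if "R \<in> unitary_group" for R
  proof -
    have "inner D (M ** R) = Re (trace (R ** (D ** M)))"
      by (subst trace_mul_sym) (simp add: inner_eq_trace D_adj matrix_mul_assoc)
    then show ?thesis
      using max[of "mat 1" R] that by (simp add: unitary_mat_1 inner_eq_trace[of D M] D_adj)
  qed
  have MD: "(M ** D) $ i $ j = M $ i $ j * of_real (d j)" for i j by (simp add: D_def d_def)
  have DM: "(D ** M) $ i $ j = of_real (d i) * M $ i $ j" for i j by (simp add: D_def d_def)
  have off: "M $ j $ i = 0" if "i \<noteq> j" for i j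
  proof -
    have 1: "M $ j $ i * of_real (d i) = cnj (M $ i $ j) * of_real (d j)"
      using hermitian_if_trace_maximal(1)[OF left, of j i] by (simp add: MD)
    have 2: "of_real (d j) * M $ j $ i = of_real (d i) * cnj (M $ i $ j)"
      using hermitian_if_trace_maximal(1)[OF right, of j i] by (simp add: DM)
    have "M $ j $ i * of_real (d i) * of_real (d i) = M $ j $ i * of_real (d j) * of_real (d j)"
      unfolding 1 using 2 by (simp add: ac_simps)
    then have "M $ j $ i * of_real ((d i - d j) * (d i + d j)) = 0"
      by (simp add: algebra_simps)
    then show ?thesis using d_inj[of i j] d_pos[of i] d_pos[of j] that
      by (simp del: of_real_mult of_real_diff of_real_add)
  qed
  define m where "m i = Re (M $ i $ i)" for i
  have M_diag: "M $ i $ i = of_real (m i)" and m_nonneg: "m i \<ge> 0" for i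
  proof -
    have "Im (M $ i $ i) * d i = 0"
      using hermitian_if_trace_maximal(1)[OF left, of i i] by (simp add: MD complex_eq_iff)
    then show "M $ i $ i = of_real (m i)"
      using d_pos[of i] by (simp add: m_def complex_eq_iff)
    show "m i \<ge> 0"
      using hermitian_if_trace_maximal(2)[OF left, of i] d_pos[of i]
      by (simp add: MD m_def zero_le_mult_iff)
  qed
  have sorted: "m j \<le> m i" if "i < j" for i j
  proof -
    have ne: "i \<noteq> j" using that by simp
    define \<tau> where "\<tau> = (\<lambda>k. if k = i then j else if k = j then i else k)"
    have \<tau>: "\<tau> (\<tau> k) = k" "\<tau> k = l \<longleftrightarrow> k = \<tau> l" for k l by (auto simp: \<tau>_def)
    define R :: "'n cmat" where "R = (\<chi> a b. if b = \<tau> a then 1 else 0)"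
    have adjR: "adj R = R" by (auto simp: R_def vec_eq_iff \<tau>)
    have "R ** R = mat 1"
      by (auto simp: vec_eq_iff R_def matrix_matrix_mult_def mat_def \<tau>
          if_distrib[where f="\<lambda>x. x * _"] cong: if_cong)
    then have R: "R \<in> unitary_group" by (simp add: unitary_group_def adjR)
    have Mab: "M $ a $ b = (if a = b then of_real (m a) else 0)" for a b
      using off M_diag by auto
    have MR: "(M ** R) $ a $ b = (if b = \<tau> a then of_real (m a) else 0)" for a b
      unfolding matrix_matrix_mult_def
      by (simp add: Mab R_def if_distrib[where f="\<lambda>x. x * _"] cong: if_cong)
    have RD: "(R ** D) $ a $ b = (if b = \<tau> a then of_real (d b) else 0)" for a b
      unfolding D_def mult_diagonal_nth by (simp add: R_def d_def)
    have "inner (R ** D) (M ** R) = (\<Sum>a\<in>UNIV. \<Sum>b\<in>UNIV. if b = \<tau> a then d b * m a else 0)"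
      unfolding inner_cmat by (intro sum.cong refl) (simp add: MR RD)
    also have "\<dots> = (\<Sum>a\<in>UNIV. d (\<tau> a) * m a)" by simp
    finally have 1: "inner (R ** D) (M ** R) = (\<Sum>a\<in>UNIV. d (\<tau> a) * m a)" .
    have "inner D M = (\<Sum>a\<in>UNIV. \<Sum>b\<in>UNIV. if b = a then d a * m a else 0)"
      unfolding inner_cmat by (intro sum.cong refl) (simp add: Mab D_def d_def)
    also have "\<dots> = (\<Sum>a\<in>UNIV. d a * m a)" by simp
    finally have "(\<Sum>a\<in>UNIV. d (\<tau> a) * m a) \<le> (\<Sum>a\<in>UNIV. d a * m a)"
      using max[OF R R] 1 by simp
    then have "0 \<le> (\<Sum>a\<in>UNIV. d a * m a - d (\<tau> a) * m a)" by (simp add: sum_subtractf)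
    also have "\<dots> = (d i * m i - d (\<tau> i) * m i) + (d j * m j - d (\<tau> j) * m j)"
      by (rule sum_two[OF ne]) (simp add: \<tau>_def)
    also have "\<dots> = (d i - d j) * (m i - m j)"
      using ne by (simp add: \<tau>_def algebra_simps)
    finally have "0 \<le> (d i - d j) * (m i - m j)" .
    moreover have "d i - d j > 0" using that by (simp add: d_def \<delta>_def position_less_iff)
    ultimately show ?thesis by (simp add: zero_le_mult_iff)
  qed
  define \<sigma> where "\<sigma> k = (if k \<in> {1..CARD('n)} then m (inv position k) else 0)" for k
  have inv_pos: "position (inv position k :: 'n) = k" if "k \<in> {1..CARD('n)}" for k
    using that bij_betw_imp_surj_on[OF bij_betw_position[where 'n = 'n]]
    by (intro f_inv_into_f) simp
  have \<sigma>_pos: "\<sigma> (position i) = m i" for i :: 'n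
    using position_range[of i] inv_pos[of "position i"] by (simp add: \<sigma>_def position_inj)
  have "antimono_on {1..CARD('n)} \<sigma>"
  proof (rule monotone_onI)
    fix k l assume kl: "k \<in> {1..CARD('n)}" "l \<in> {1..CARD('n)}" "k \<le> l"
    obtain i j :: 'n where ij: "k = position i" "l = position j"
      using inv_pos kl by metis
    show "\<sigma> k \<ge> \<sigma> l"
    proof (cases "k = l")
      case False
      then have "i < j" using kl ij by (simp add: position_less_iff[symmetric])
      then show ?thesis using sorted by (simp add: ij \<sigma>_pos)
    qed simp
  qed
  moreover have "A = U ** diagonal_matrix \<sigma> ** adj V"
  proof -
    have "M = diagonal_matrix \<sigma>" using off M_diag by (auto simp: vec_eq_iff \<sigma>_pos)
    moreover have "U ** M ** adj V = A"
      by (simp add: M_def matrix_mul_assoc unitaryD[OF U] unitary_cancel[OF V])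
    ultimately show ?thesis by simp
  qed
  ultimately have "is_svd A U \<sigma> V"
    using U V m_nonneg by (auto simp: is_svd_def \<sigma>_def)
  then show thesis by (rule that)
qed


section \<open>Low-rank approximation\<close>

lemma rank_mult_le: "rank (A ** B) \<le> rank B" for A B :: "('n::finite) cmat"
proof -
  have "rows (A ** B) \<subseteq> vec.span (rows B)"
  proof
    fix x assume "x \<in> rows (A ** B)"
    then obtain i where x: "x = row i (A ** B)" by (auto simp: rows_def)
    have "x = (\<Sum>k\<in>UNIV. A $ i $ k *s row k B)"
      by (simp add: x row_def vec_eq_iff matrix_matrix_mult_def)
    moreover have "row k B \<in> vec.span (rows B)" for k
      by (rule vec.span_base) (auto simp: rows_def)
    ultimately show "x \<in> vec.span (rows B)"
      by (auto intro!: vec.span_sum vec.span_scale)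
  qed
  then have "vec.dim (rows (A ** B)) \<le> vec.dim (vec.span (rows B))" by (rule vec.dim_subset)
  then show ?thesis by (simp add: row_rank_def_gen)
qed

text \<open>
  The rows of \<open>\<Sigma> V\<^sup>*\<close> are the multiples by \<open>\<sigma>\<^sub>i\<close> of the rows of \<open>V\<^sup>*\<close>; multiplication by \<open>V\<close>
  reads off the coefficients of a linear relation between them, so that the nonzero ones are
  independent.
\<close>

lemma rank_unitary_diagonal:
  fixes U V :: "('n::{finite,linorder}) cmat"
  assumes U: "U \<in> unitary_group" and V: "V \<in> unitary_group"
  shows "rank (U ** diagonal_matrix \<sigma> ** adj V) = card {i :: 'n. \<sigma> (position i) \<noteq> 0}"
proof -
  define C where "C = diagonal_matrix \<sigma> ** adj V"
  define S where "S = {i :: 'n. \<sigma> (position i) \<noteq> 0}"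
  have CV: "C ** V = diagonal_matrix \<sigma>" by (simp add: C_def unitary_cancel[OF V])
  have row_V: "(\<Sum>k\<in>UNIV. row i C $ k * V $ k $ j) = (if i = j then of_real (\<sigma> (position i)) else 0)"
    for i j
  proof -
    have "(\<Sum>k\<in>UNIV. row i C $ k * V $ k $ j) = (C ** V) $ i $ j"
      by (simp add: matrix_matrix_mult_def row_def)
    then show ?thesis unfolding CV diagonal_matrix_nth .
  qed
  have inj: "inj_on (\<lambda>i. row i C) S"
  proof (rule inj_onI)
    fix i j assume ij: "i \<in> S" "j \<in> S" "row i C = row j C"
    have "(if j = i then of_real (\<sigma> (position j)) else 0) = complex_of_real (\<sigma> (position i))"
      using row_V[of i i] row_V[of j i] unfolding ij(3) by simp
    then show "i = j" using ij(1) by (auto simp: S_def split: if_splits)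
  qed
  have indep: "vec.independent ((\<lambda>i. row i C) ` S)"
  proof (rule vec.independent_if_scalars_zero)
    fix f x
    assume f: "(\<Sum>x\<in>(\<lambda>i. row i C) ` S. f x *s x) = 0" and "x \<in> (\<lambda>i. row i C) ` S"
    then obtain j where j: "j \<in> S" "x = row j C" by blast
    from f have f0: "(\<Sum>i\<in>S. f (row i C) *s row i C) = 0"
      by (subst (asm) sum.reindex[OF inj]) simp
    have "(\<Sum>k\<in>UNIV. (\<Sum>i\<in>S. f (row i C) *s row i C) $ k * V $ k $ j)
        = (\<Sum>k\<in>UNIV. \<Sum>i\<in>S. f (row i C) * (row i C $ k * V $ k $ j))"
      by (simp add: sum_distrib_right mult.assoc)
    also have "\<dots> = (\<Sum>i\<in>S. f (row i C) * (\<Sum>k\<in>UNIV. row i C $ k * V $ k $ j))"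
      by (subst sum.swap) (simp add: sum_distrib_left)
    also have "\<dots> = f (row j C) * of_real (\<sigma> (position j))"
      unfolding row_V using j
      by (simp add: if_distrib[where f="\<lambda>x. _ * x"] cong: if_cong)
    finally have "f (row j C) * of_real (\<sigma> (position j)) = 0" unfolding f0 by simp
    then show "f x = 0" using j by (simp add: S_def)
  qed simp
  have "rows C \<subseteq> vec.span ((\<lambda>i. row i C) ` S)"
  proof
    fix x assume "x \<in> rows C"
    then obtain i where i: "x = row i C" by (auto simp: rows_def)
    show "x \<in> vec.span ((\<lambda>i. row i C) ` S)"
    proof (cases "i \<in> S")
      case True
      then show ?thesis using i by (auto intro: vec.span_base)
    next
      case False
      then have "x = 0" by (simp add: i C_def row_def vec_eq_iff S_def)
      then show ?thesis by (simp add: vec.span_zero)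
    qed
  qed
  moreover have "(\<lambda>i. row i C) ` S \<subseteq> rows C" by (auto simp: rows_def)
  ultimately have "rank C = card S"
    unfolding row_rank_def_gen using indep card_image[OF inj] by (intro vec.dim_unique) auto
  moreover have "rank C \<le> rank (U ** C)" "rank (U ** C) \<le> rank C"
    using rank_mult_le[of "adj U" "U ** C"] rank_mult_le[of U C] by (simp_all add: unitary_cancel[OF U])
  ultimately show ?thesis by (simp add: C_def S_def matrix_mul_assoc)
qed

definition truncate_at :: "nat \<Rightarrow> (nat \<Rightarrow> real) \<Rightarrow> nat \<Rightarrow> real" where
  "truncate_at r \<sigma> k = (if k \<le> r then \<sigma> k else 0)"

lemma card_position_le: "r \<le> CARD('n) \<Longrightarrow> card {i :: 'n::{finite,linorder}. position i \<le> r} = r"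
proof -
  assume r: "r \<le> CARD('n)"
  have "card {i :: 'n. position i \<le> r} = (\<Sum>i\<in>UNIV. if position (i :: 'n) \<le> r then 1 else 0)"
    by (simp add: sum.If_cases)
  also have "\<dots> = (\<Sum>k=1..CARD('n). if k \<le> r then 1 else 0)"
    by (rule sum_position[of "\<lambda>k. if k \<le> r then 1 else 0"])
  also have "\<dots> = card ({1..CARD('n)} \<inter> {k. k \<le> r})" by (simp add: sum.If_cases)
  also have "{1..CARD('n)} \<inter> {k. k \<le> r} = {1..r}" using r by auto
  finally show ?thesis by simp
qed

lemma rank_truncated_svd:
  fixes U V :: "('n::{finite,linorder}) cmat"
  assumes "U \<in> unitary_group" "V \<in> unitary_group" "r \<le> CARD('n)"
  shows "rank (U ** diagonal_matrix (truncate_at r \<sigma>) ** adj V) \<le> r"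
proof -
  have "card {i :: 'n. truncate_at r \<sigma> (position i) \<noteq> 0} \<le> card {i :: 'n. position i \<le> r}"
    by (rule card_mono) (auto simp: truncate_at_def)
  then show ?thesis using assms card_position_le[OF assms(3)]
    by (simp add: rank_unitary_diagonal)
qed

lemma dist_truncated_svd:
  assumes "is_svd (A :: ('n::{finite,linorder}) cmat) U \<sigma> V"
  shows "(norm (A - U ** diagonal_matrix (truncate_at r \<sigma>) ** adj V))\<^sup>2
    = (\<Sum>k=r+1..CARD('n). (\<sigma> k)\<^sup>2)"
proof -
  from assms have U: "U \<in> unitary_group" and V: "V \<in> unitary_group"
    and A: "A = U ** diagonal_matrix \<sigma> ** adj V" by (auto simp: is_svd_def)
  have "diagonal_matrix \<sigma> - diagonal_matrix (truncate_at r \<sigma>)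
      = (diagonal_matrix (\<lambda>k. if k \<le> r then 0 else \<sigma> k) :: 'n cmat)"
    by (simp add: vec_eq_iff truncate_at_def)
  then have "A - U ** diagonal_matrix (truncate_at r \<sigma>) ** adj V
      = U ** diagonal_matrix (\<lambda>k. if k \<le> r then 0 else \<sigma> k) ** adj V"
    unfolding A matrix_diff_ldistrib[symmetric] matrix_diff_rdistrib[symmetric] by simp
  then have "(norm (A - U ** diagonal_matrix (truncate_at r \<sigma>) ** adj V))\<^sup>2
      = (norm (diagonal_matrix (\<lambda>k. if k \<le> r then 0 else \<sigma> k) :: 'n cmat))\<^sup>2"
    using U V by simp
  also have "\<dots> = (\<Sum>k=1..CARD('n). (if k \<le> r then 0 else \<sigma> k)\<^sup>2)"
    by (rule norm_diagonal_squared)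
  also have "\<dots> = (\<Sum>k=r+1..CARD('n). (\<sigma> k)\<^sup>2)"
    by (rule sum.mono_neutral_cong_right) auto
  finally show ?thesis .
qed

text \<open>
  The left singular vectors of \<open>B\<close> for nonzero singular values are an orthonormal basis of the
  range of \<open>B\<close>, and \<open>P\<close> is the orthogonal projection onto their span.
\<close>

lemma range_projection:
  fixes B :: "('n::{finite,linorder}) cmat"
  obtains P where "adj P = P" "P ** P = P" "P ** B = B" "(norm P)\<^sup>2 = real (rank B)"
proof -
  obtain U \<sigma> V where svd: "is_svd B U \<sigma> V" by (rule svd_exists)
  then have U: "U \<in> unitary_group" and V: "V \<in> unitary_group"
    and B: "B = U ** diagonal_matrix \<sigma> ** adj V" by (auto simp: is_svd_def)
  define \<epsilon> where "\<epsilon> k = (if \<sigma> k = 0 then 0 else 1 :: real)" for k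
  define P where "P = U ** diagonal_matrix \<epsilon> ** adj U"
  have PU: "P ** U = U ** diagonal_matrix \<epsilon>" by (simp add: P_def unitary_cancel[OF U])
  have e\<sigma>: "diagonal_matrix \<epsilon> ** diagonal_matrix \<sigma> = (diagonal_matrix \<sigma> :: 'n cmat)"
    and ee: "diagonal_matrix \<epsilon> ** diagonal_matrix \<epsilon> = (diagonal_matrix \<epsilon> :: 'n cmat)"
    by (auto simp: vec_eq_iff \<epsilon>_def)
  have "adj P = P" by (simp add: P_def adj_mult matrix_mul_assoc)
  moreover have "P ** P = P"
  proof -
    have "P ** P = (P ** U) ** diagonal_matrix \<epsilon> ** adj U"
      by (subst (2) P_def) (simp add: matrix_mul_assoc)
    also have "\<dots> = U ** (diagonal_matrix \<epsilon> ** diagonal_matrix \<epsilon>) ** adj U"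
      by (simp only: PU matrix_mul_assoc)
    finally show ?thesis by (simp only: ee P_def)
  qed
  moreover have "P ** B = B"
  proof -
    have "P ** B = (P ** U) ** diagonal_matrix \<sigma> ** adj V"
      by (simp add: B matrix_mul_assoc)
    also have "\<dots> = U ** (diagonal_matrix \<epsilon> ** diagonal_matrix \<sigma>) ** adj V"
      by (simp only: PU matrix_mul_assoc)
    finally show ?thesis by (simp only: e\<sigma> B)
  qed
  moreover have "(norm P)\<^sup>2 = real (rank B)"
  proof -
    have "(norm P)\<^sup>2 = (norm (diagonal_matrix \<epsilon> :: 'n cmat))\<^sup>2"
      using U by (simp add: P_def)
    also have "\<dots> = (\<Sum>k=1..CARD('n). (\<epsilon> k)\<^sup>2)"
      by (rule norm_diagonal_squared)
    also have "\<dots> = (\<Sum>i\<in>UNIV. (\<epsilon> (position (i::'n)))\<^sup>2)"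
      by (rule sum_position[symmetric])
    also have "\<dots> = (\<Sum>i\<in>UNIV. if \<sigma> (position (i::'n)) \<noteq> 0 then 1 else 0)"
      by (intro sum.cong) (auto simp: \<epsilon>_def)
    also have "\<dots> = real (rank B)"
      unfolding B rank_unitary_diagonal[OF U V] by (simp add: sum.If_cases)
    finally show ?thesis .
  qed
  ultimately show thesis by (rule that)
qed

text \<open>
  Let \<open>P\<close> be the projection onto the range of \<open>B\<close>.  Pythagoras gives
  \<open>\<parallel>A - B\<parallel>\<^sup>2 = \<parallel>A - P A\<parallel>\<^sup>2 + \<parallel>P A - B\<parallel>\<^sup>2\<close>, and \<open>\<parallel>P A\<parallel>\<^sup>2\<close> is the sum of the \<open>\<sigma>\<^sub>j\<^sup>2\<close> with
  weights \<open>q\<^sub>j \<in> [0, 1]\<close> of total mass at most \<open>r\<close>, hence at most the sum of the \<open>r\<close> largest.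
  If there is a gap after \<open>\<sigma>\<^sub>r\<close>, equality leaves no choice for the weights.
\<close>

theorem eckart_young:
  fixes A B :: "('n::{finite,linorder}) cmat"
  assumes svd: "is_svd A U \<sigma> V" and r: "r \<le> CARD('n)" and rank: "rank B \<le> r"
  shows "(\<Sum>k=r+1..CARD('n). (\<sigma> k)\<^sup>2) \<le> (norm (A - B))\<^sup>2"
    and "\<lbrakk>\<sigma> (r + 1) < \<sigma> r; (norm (A - B))\<^sup>2 \<le> (\<Sum>k=r+1..CARD('n). (\<sigma> k)\<^sup>2)\<rbrakk>
      \<Longrightarrow> B = U ** diagonal_matrix (truncate_at r \<sigma>) ** adj V"
proof -
  from svd have U: "U \<in> unitary_group" and V: "V \<in> unitary_group"
    and A: "A = U ** diagonal_matrix \<sigma> ** adj V"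
    and anti: "\<And>k l. k \<in> {1..CARD('n)} \<Longrightarrow> l \<in> {1..CARD('n)} \<Longrightarrow> k \<le> l \<Longrightarrow> \<sigma> l \<le> \<sigma> k"
    and nonneg: "\<And>k. 0 \<le> \<sigma> k" and outside: "\<And>k. k \<notin> {1..CARD('n)} \<Longrightarrow> \<sigma> k = 0"
    by (auto simp: is_svd_def monotone_on_def)
  obtain P where P: "adj P = P" "P ** P = P" "P ** B = B" and nP: "(norm P)\<^sup>2 = real (rank B)"
    by (rule range_projection)
  have PP: "P ** (P ** X) = P ** X" for X :: "'n cmat" by (simp add: matrix_mul_assoc P)
  have pyth: "(norm (X - Y))\<^sup>2 = (norm (X - P ** X))\<^sup>2 + (norm (P ** X - Y))\<^sup>2"
    if "P ** Y = Y" for X Y :: "'n cmat"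
  proof -
    have "inner (X - P ** X) (P ** (X - Y)) = inner (P ** (X - P ** X)) (X - Y)"
      by (subst inner_mult_left) (simp only: P)
    also have "\<dots> = 0" by (simp add: matrix_diff_ldistrib PP)
    finally have "orthogonal (X - P ** X) (P ** X - Y)"
      by (simp add: orthogonal_def matrix_diff_ldistrib that)
    then have "(norm ((X - P ** X) + (P ** X - Y)))\<^sup>2
        = (norm (X - P ** X))\<^sup>2 + (norm (P ** X - Y))\<^sup>2"
      by (rule norm_add_Pythagorean)
    then show ?thesis by simp
  qed
  define G where "G = P ** U"
  define q where "q j = (\<Sum>i\<in>UNIV. (cmod (G $ i $ j))\<^sup>2)" for j
  define h where "h j = (\<Sum>i\<in>UNIV. (cmod ((U - G) $ i $ j))\<^sup>2)" for j
  define s where "s j = (\<sigma> (position j))\<^sup>2" for j :: 'n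
  have q_nonneg: "0 \<le> q j" and h_nonneg: "0 \<le> h j" for j by (simp_all add: q_def h_def sum_nonneg)
  have qh: "q j + h j = 1" for j
  proof -
    have col: "of_real (\<Sum>i\<in>UNIV. (cmod (X $ i $ j))\<^sup>2) = (adj X ** X) $ j $ j" for X :: "'n cmat"
      unfolding of_real_sum complex_norm_square by (simp add: matrix_matrix_mult_def mult.commute)
    have "adj G ** G + adj (U - G) ** (U - G) = adj U ** U"
      by (simp add: G_def adj_mult P PP matrix_ring_simps flip: matrix_mul_assoc)
    then have "(adj G ** G) $ j $ j + (adj (U - G) ** (U - G)) $ j $ j = 1"
      by (simp add: unitaryD[OF U] vec_eq_iff mat_def)
    then have "complex_of_real (q j + h j) = 1" unfolding col[symmetric] q_def h_def by simp
    then show ?thesis using of_real_eq_1_iff by blast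
  qed
  have sum_q: "(\<Sum>j\<in>UNIV. q j) \<le> real r"
  proof -
    have "(\<Sum>j\<in>UNIV. q j) = (norm G)\<^sup>2"
      unfolding norm_cmat_squared q_def by (rule sum.swap)
    also have "\<dots> = real (rank B)" using U nP by (simp add: G_def)
    finally show ?thesis using rank by simp
  qed
  have nPA: "(norm (P ** A))\<^sup>2 = (\<Sum>j\<in>UNIV. s j * q j)"
  proof -
    have "P ** A = (G ** diagonal_matrix \<sigma>) ** adj V" by (simp add: A G_def matrix_mul_assoc)
    then have "(norm (P ** A))\<^sup>2 = (norm (G ** diagonal_matrix \<sigma>))\<^sup>2" using V by simp
    also have "\<dots> = (\<Sum>i\<in>UNIV. \<Sum>j\<in>UNIV. s j * (cmod (G $ i $ j))\<^sup>2)"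
      unfolding norm_cmat_squared
      by (intro sum.cong refl) (simp add: s_def norm_mult power_mult_distrib)
    also have "\<dots> = (\<Sum>j\<in>UNIV. s j * q j)"
      by (subst sum.swap) (simp add: q_def sum_distrib_left)
    finally show ?thesis .
  qed
  have nA: "(norm A)\<^sup>2 = (\<Sum>j\<in>UNIV. s j)"
    using U V by (simp add: A norm_diagonal_squared s_def sum_position[of "\<lambda>k. (\<sigma> k)\<^sup>2"])
  define \<iota> where "\<iota> j = (if position j \<le> r then 1 else 0 :: real)" for j :: 'n
  have sum_\<iota>: "(\<Sum>j\<in>UNIV. \<iota> j) = real r"
    using card_position_le[OF r] by (simp add: \<iota>_def sum.If_cases)
  have tail: "(\<Sum>k=r+1..CARD('n). (\<sigma> k)\<^sup>2) = (\<Sum>j\<in>UNIV. s j) - (\<Sum>j\<in>UNIV. s j * \<iota> j)"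
  proof -
    have "(\<Sum>k=r+1..CARD('n). (\<sigma> k)\<^sup>2) = (\<Sum>k=1..CARD('n). if k \<le> r then 0 else (\<sigma> k)\<^sup>2)"
      by (rule sum.mono_neutral_cong_left) auto
    also have "\<dots> = (\<Sum>j\<in>UNIV. if position (j::'n) \<le> r then 0 else (\<sigma> (position j))\<^sup>2)"
      by (rule sum_position[symmetric])
    also have "\<dots> = (\<Sum>j\<in>UNIV. s j - s j * \<iota> j)"
      by (intro sum.cong) (auto simp: s_def \<iota>_def)
    finally show ?thesis by (simp add: sum_subtractf)
  qed
  define \<tau> where "\<tau> = (\<sigma> (r + 1))\<^sup>2"
  have head_ge: "\<tau> \<le> s j" if "position j \<le> r" for j
  proof (cases "r < CARD('n)")
    case True
    then show ?thesis using anti[of "position j" "r + 1"] position_range[of j] that nonneg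
      by (auto simp: \<tau>_def s_def intro!: power_mono)
  next
    case False
    then show ?thesis using outside[of "r + 1"] by (simp add: \<tau>_def s_def)
  qed
  have tail_le: "s j \<le> \<tau>" if "\<not> position j \<le> r" for j
    using anti[of "r + 1" "position j"] position_range[of j] that nonneg
    by (auto simp: \<tau>_def s_def intro!: power_mono)
  have terms: "(s j - \<tau>) * (\<iota> j - q j) \<ge> 0" for j
    using head_ge[of j] tail_le[of j] qh[of j] q_nonneg[of j] h_nonneg[of j]
    by (auto simp: \<iota>_def zero_le_mult_iff)
  have sum_terms: "0 \<le> (\<Sum>j\<in>UNIV. (s j - \<tau>) * (\<iota> j - q j))" by (intro sum_nonneg terms)
  have expand: "(\<Sum>j\<in>UNIV. s j * \<iota> j) - (\<Sum>j\<in>UNIV. s j * q j)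
      = (\<Sum>j\<in>UNIV. (s j - \<tau>) * (\<iota> j - q j)) + \<tau> * (real r - (\<Sum>j\<in>UNIV. q j))"
    unfolding sum_\<iota>[symmetric]
    by (simp add: sum_subtractf[symmetric] sum_distrib_left sum.distrib[symmetric] algebra_simps)
  have \<tau>_part: "\<tau> * (real r - (\<Sum>j\<in>UNIV. q j)) \<ge> 0" using sum_q by (simp add: \<tau>_def)
  have total: "(norm (A - B))\<^sup>2 = (\<Sum>j\<in>UNIV. s j) - (\<Sum>j\<in>UNIV. s j * q j) + (norm (P ** A - B))\<^sup>2"
  proof -
    have "(norm A)\<^sup>2 = (norm (A - P ** A))\<^sup>2 + (norm (P ** A))\<^sup>2"
      using pyth[of 0 A] by simp
    then show ?thesis using pyth[of B A] P nPA nA by simp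
  qed
  show "(\<Sum>k=r+1..CARD('n). (\<sigma> k)\<^sup>2) \<le> (norm (A - B))\<^sup>2"
    unfolding tail total
    using expand \<tau>_part sum_terms zero_le_power2[of "norm (P ** A - B)"] by linarith
  assume gap: "\<sigma> (r + 1) < \<sigma> r" and eq: "(norm (A - B))\<^sup>2 \<le> (\<Sum>k=r+1..CARD('n). (\<sigma> k)\<^sup>2)"
  have zero: "(\<Sum>j\<in>UNIV. (s j - \<tau>) * (\<iota> j - q j)) = 0" and "(norm (P ** A - B))\<^sup>2 = 0"
    using eq expand \<tau>_part sum_terms zero_le_power2[of "norm (P ** A - B)"]
    unfolding tail total by linarith+
  then have PA: "P ** A = B" by simp
  have each: "(s j - \<tau>) * (\<iota> j - q j) = 0" for j
    using zero terms by (subst (asm) sum_nonneg_eq_0_iff) auto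
  have r_range: "r \<in> {1..CARD('n)}" using gap nonneg[of "r + 1"] outside[of r] by force
  have head: "q j = 1" if "position j \<le> r" for j
  proof -
    have "\<sigma> r \<le> \<sigma> (position j)" using anti[of "position j" r] position_range[of j] r_range that by auto
    then have "\<sigma> (r + 1) < \<sigma> (position j)" using gap by linarith
    then have "\<tau> < s j" using nonneg[of "r + 1"] unfolding \<tau>_def s_def by (intro power_strict_mono) auto
    then show ?thesis using each[of j] that by (simp add: \<iota>_def)
  qed
  have tail_q: "q j = 0" if "\<not> position j \<le> r" for j
  proof -
    have le: "\<iota> k \<le> q k" for k using head[of k] q_nonneg[of k] by (simp add: \<iota>_def)
    have "(\<Sum>k\<in>UNIV. q k - \<iota> k) \<le> 0" using sum_q sum_\<iota> by (simp add: sum_subtractf)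
    moreover have "(\<Sum>k\<in>UNIV. q k - \<iota> k) \<ge> 0" using le by (intro sum_nonneg) simp
    ultimately have "(\<Sum>k\<in>UNIV. q k - \<iota> k) = 0" by simp
    then have "q j - \<iota> j = 0" using le by (subst (asm) sum_nonneg_eq_0_iff) auto
    then show ?thesis using that by (simp add: \<iota>_def)
  qed
  have "G $ i $ j = U $ i $ j" if "position j \<le> r" for i j
  proof -
    have "h j = 0" using head[OF that] qh[of j] by simp
    then have "(cmod ((U - G) $ i $ j))\<^sup>2 = 0"
      unfolding h_def by (subst (asm) sum_nonneg_eq_0_iff) auto
    then show ?thesis by simp
  qed
  moreover have "G $ i $ j = 0" if "\<not> position j \<le> r" for i j
    using tail_q[OF that] unfolding q_def by (subst (asm) sum_nonneg_eq_0_iff) auto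
  ultimately have "G ** diagonal_matrix \<sigma> = U ** diagonal_matrix (truncate_at r \<sigma>)"
    unfolding vec_eq_iff by (auto simp: truncate_at_def)
  moreover have "B = (G ** diagonal_matrix \<sigma>) ** adj V"
    unfolding PA[symmetric] A G_def by (simp add: matrix_mul_assoc)
  ultimately show "B = U ** diagonal_matrix (truncate_at r \<sigma>) ** adj V" by simp
qed

text \<open>
  By Eckart--Young the tails of the squared singular values are distances to matrices of
  bounded rank, so they do not depend on the decomposition.
\<close>

lemma svd_values_unique:
  fixes A :: "('n::{finite,linorder}) cmat"
  assumes 1: "is_svd A U \<sigma> V" and 2: "is_svd A U' \<tau> V'"
  shows "\<sigma> = \<tau>"
proof
  have le: "(\<Sum>k=r+1..CARD('n). (\<sigma> k)\<^sup>2) \<le> (\<Sum>k=r+1..CARD('n). (\<tau> k)\<^sup>2)"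
    if "is_svd A U \<sigma> V" "is_svd A U' \<tau> V'" "r \<le> CARD('n)" for r \<sigma> \<tau> U V U' V'
    using eckart_young(1)[OF that(1,3) rank_truncated_svd[of U' V' r \<tau>]] dist_truncated_svd[OF that(2)] that
    by (auto simp: is_svd_def)
  have tails: "(\<Sum>k=r+1..CARD('n). (\<sigma> k)\<^sup>2) = (\<Sum>k=r+1..CARD('n). (\<tau> k)\<^sup>2)"
    if "r \<le> CARD('n)" for r
    using le[OF 1 2 that] le[OF 2 1 that] by simp
  fix k
  show "\<sigma> k = \<tau> k"
  proof (cases "k \<in> {1..CARD('n)}")
    case True
    have split: "(\<Sum>i=k-1+1..CARD('n). f i) = f k + (\<Sum>i=k+1..CARD('n). f i)" for f :: "nat \<Rightarrow> real"
      using True by (simp add: sum.atLeast_Suc_atMost)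
    have "k - 1 \<le> CARD('n)" "k \<le> CARD('n)" using True by auto
    from tails[OF this(1)] tails[OF this(2)] have "(\<sigma> k)\<^sup>2 = (\<tau> k)\<^sup>2"
      unfolding split by linarith
    then show ?thesis using 1 2 by (simp add: is_svd_def power2_eq_iff_nonneg)
  qed (use 1 2 in \<open>auto simp: is_svd_def\<close>)
qed

lemma singular_value_eq:
  assumes "is_svd A U \<sigma> V"
  shows "singular_value A = \<sigma>"
  unfolding singular_value_def
proof (rule the_equality)
  show "antimono_on {1..CARD('a)} \<sigma> \<and> (\<forall>i. 0 \<le> \<sigma> i) \<and> (\<forall>i. i \<notin> {1..CARD('a)} \<longrightarrow> \<sigma> i = 0) \<and>
      (\<exists>U\<in>unitary_group. \<exists>V\<in>unitary_group. A = U ** diagonal_matrix \<sigma> ** adj V)"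
    using assms by (auto simp: is_svd_def)
next
  fix \<tau>
  assume "antimono_on {1..CARD('a)} \<tau> \<and> (\<forall>i. 0 \<le> \<tau> i) \<and> (\<forall>i. i \<notin> {1..CARD('a)} \<longrightarrow> \<tau> i = 0) \<and>
      (\<exists>U\<in>unitary_group. \<exists>V\<in>unitary_group. A = U ** diagonal_matrix \<tau> ** adj V)"
  then obtain U' V' where "is_svd A U' \<tau> V'" by (auto simp: is_svd_def)
  then show "\<tau> = \<sigma>" using svd_values_unique[OF assms] by simp
qed

text \<open>
  \<open>best_rank_approx\<close> is only some minimiser of the distance; the gap in the singular values
  leaves the truncated decomposition as the only candidate.  For \<open>r = N\<close> the minimal distance
  is \<open>0\<close>, whatever the singular values are.
\<close>

lemma best_rank_approx_eq:
  fixes A :: "('n::{finite,linorder}) cmat"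
  assumes svd: "is_svd A U \<sigma> V" and r: "r \<le> CARD('n)" and gap: "r < CARD('n) \<Longrightarrow> \<sigma> (r + 1) < \<sigma> r"
  shows "best_rank_approx r A = U ** diagonal_matrix (truncate_at r \<sigma>) ** adj V"
proof -
  define Z where "Z = U ** diagonal_matrix (truncate_at r \<sigma>) ** adj V"
  from svd have U: "U \<in> unitary_group" and V: "V \<in> unitary_group" by (auto simp: is_svd_def)
  have rZ: "rank Z \<le> r" unfolding Z_def by (rule rank_truncated_svd[OF U V r])
  have dZ: "(norm (A - Z))\<^sup>2 = (\<Sum>k=r+1..CARD('n). (\<sigma> k)\<^sup>2)"
    unfolding Z_def by (rule dist_truncated_svd[OF svd])
  have "is_arg_min (\<lambda>B. norm (A - B)) (\<lambda>B. B \<in> {B. rank B \<le> r}) Z"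
    unfolding is_arg_min_def
    using rZ eckart_young(1)[OF svd r] unfolding dZ[symmetric]
    by (auto simp: not_less abs_le_square_iff[symmetric])
  then have "is_arg_min (\<lambda>B. norm (A - B)) (\<lambda>B. B \<in> {B. rank B \<le> r}) (best_rank_approx r A)"
    unfolding best_rank_approx_def arg_min_on_def arg_min_def by (rule someI)
  then have rank: "rank (best_rank_approx r A) \<le> r"
    and dist: "norm (A - best_rank_approx r A) \<le> norm (A - Z)"
    using rZ by (auto simp: is_arg_min_def not_less)
  show ?thesis
  proof (cases "r < CARD('n)")
    case True
    have "(norm (A - best_rank_approx r A))\<^sup>2 \<le> (\<Sum>k=r+1..CARD('n). (\<sigma> k)\<^sup>2)"
      unfolding dZ[symmetric] using dist by (simp add: power_mono)
    then show ?thesis by (rule eckart_young(2)[OF svd r rank gap[OF True]])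
  next
    case False
    then have "norm (A - Z) = 0" using dZ r by simp
    then show ?thesis using dist by (simp add: Z_def)
  qed
qed

lemma is_svd_unitary_mult:
  assumes "is_svd A U \<sigma> V" "R \<in> unitary_group" "S \<in> unitary_group"
  shows "is_svd (R ** A ** adj S) (R ** U) \<sigma> (S ** V)"
  using assms by (auto simp: is_svd_def unitary_mult adj_mult matrix_mul_assoc)

text \<open>
  For a skew-Hermitian matrix this is a second decomposition of the same matrix, from which the
  truncation is seen to be skew-Hermitian again.
\<close>

lemma is_svd_minus_adj:
  assumes "is_svd A U \<sigma> V"
  shows "is_svd (- adj A) (- V) \<sigma> U"
  using assms by (auto simp: is_svd_def unitary_minus adj_mult matrix_mul_assoc matrix_ring_simps)


section \<open>Racah's sum and its three-term recurrence\<close>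

text \<open>
  The reciprocal factorial, with \<open>1 / x! = 0\<close> for negative \<open>x\<close>.  With this convention the
  recursion \<open>1 / (x - 1)! = x / x!\<close> holds for all integers, and the bounds of summation in
  Racah's formula take care of themselves.
\<close>

definition rfact :: "int \<Rightarrow> real" where
  "rfact x = (if x < 0 then 0 else 1 / fact (nat x))"

lemma rfact_rec: "rfact (x - 1) = of_int x * rfact x"
proof (cases "x \<le> 0")
  case True
  then show ?thesis by (cases "x = 0") (auto simp: rfact_def)
next
  case False
  then have "nat x = Suc (nat (x - 1))" by simp
  then show ?thesis using False by (simp add: rfact_def field_simps del: nat_diff_distrib)
qed

lemma rfact_neg: "x < 0 \<Longrightarrow> rfact x = 0"
  by (simp add: rfact_def)

lemma rfact_pos: "x \<ge> 0 \<Longrightarrow> rfact x > 0"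
  by (simp add: rfact_def)

text \<open>
  The summands of Racah's formula for \<open>j1 = j3 = n / 2\<close>, \<open>j2 = l\<close>, \<open>m1 = n / 2 - a\<close>, \<open>m2 = m\<close>.
  The last two factors, the only ones that depend on \<open>a\<close>, are a binomial coefficient up to the
  constant \<open>(n - l)!\<close>.
\<close>

definition racah_term :: "int \<Rightarrow> nat \<Rightarrow> int \<Rightarrow> int \<Rightarrow> nat \<Rightarrow> real" where
  "racah_term n l m a k =
     (-1) ^ k * rfact (int k) * rfact (int l - int k) * rfact (int l + m - int k)
     * rfact (int k - m) * (rfact (a - int k) * rfact (n - a - int l + int k))"

definition racah_sum :: "int \<Rightarrow> nat \<Rightarrow> int \<Rightarrow> int \<Rightarrow> real" where
  "racah_sum n l m a = (\<Sum>k\<le>l. racah_term n l m a k)"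

text \<open>
  These are the neighbours that the recurrence below reaches when \<open>a\<close> or \<open>a - m\<close> is at an end
  of \<open>0, \<dots>, n\<close>; they drop out, so no boundary cases arise.
\<close>

lemma racah_sum_outside:
  assumes "a < 0 \<or> a > n \<or> a - m < 0 \<or> a - m > n"
  shows "racah_sum n l m a = 0"
proof -
  have "racah_term n l m a k = 0" if "k \<le> l" for k
  proof -
    have "a - int k < 0 \<or> n - a - int l + int k < 0 \<or> int k - m < 0 \<or> int l + m - int k < 0"
      using assms that by linarith
    then show ?thesis by (auto simp: racah_term_def rfact_neg)
  qed
  then show ?thesis by (simp add: racah_sum_def)
qed

text \<open>
  Creative telescoping: applied to a single summand, the three-term operator in \<open>a\<close> gives a
  difference \<open>G (k + 1) - G k\<close>, and \<open>G\<close> vanishes at both ends of the sum.  The certificate \<open>G\<close>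
  comes from the first-order recurrences of the two groups of factors,
  \<open>(k + 1) (k + 1 - m) g\<^bsub>k+1\<^esub> = - (l - k) (l + m - k) g\<^sub>k\<close> for those without \<open>a\<close> and
  \<open>(j + 1) u\<^bsub>j+1\<^esub> = (n - l - j) u\<^sub>j\<close>, \<open>j = a - k\<close>, for the binomial coefficient.
\<close>

lemma racah_sum_recurrence:
  fixes n m a :: int and l :: nat
  defines "b \<equiv> a - m"
  shows "(of_int (n * (n + 2)) / 2 - 2 * (of_int a - of_int n / 2) * (of_int b - of_int n / 2))
        * racah_sum n l m a
      - of_int ((n - a + 1) * (n - b + 1)) * racah_sum n l m (a - 1)
      - of_int ((a + 1) * (b + 1)) * racah_sum n l m (a + 1)
    = of_nat (l * (l + 1)) * racah_sum n l m a"
proof -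
  define u where "u j = rfact j * rfact (n - int l - j)" for j
  define G where "G k = (-1) ^ k * rfact (int k - 1) * rfact (int l - int k)
      * rfact (int l + m - int k) * rfact (int k - 1 - m) * (u (a + 1 - int k) + u (a - int k))" for k
  have step: "(of_int (n * (n + 2)) / 2 - 2 * (of_int a - of_int n / 2) * (of_int b - of_int n / 2)
          - of_nat (l * (l + 1))) * racah_term n l m a k
      - of_int ((n - a + 1) * (n - b + 1)) * racah_term n l m (a - 1) k
      - of_int ((a + 1) * (b + 1)) * racah_term n l m (a + 1) k = G (Suc k) - G k" for k
  proof -
    define j M where "j = a - int k" and "M = n - int l"
    define g where "g = (-1) ^ k * rfact (int k) * rfact (int l - int k)
        * rfact (int l + m - int k) * rfact (int k - m)"
    define p q where "p = rfact (j + 1)" and "q = rfact (M - j + 1)"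
    have j0: "rfact j = (of_int j + 1) * p" and j1: "rfact (j - 1) = of_int j * ((of_int j + 1) * p)"
      using rfact_rec[of "j + 1"] rfact_rec[of j] by (simp_all add: p_def)
    have M0: "rfact (M - j) = (of_int M - of_int j + 1) * q"
      and M1: "rfact (M - j - 1) = (of_int M - of_int j) * ((of_int M - of_int j + 1) * q)"
      using rfact_rec[of "M - j + 1"] rfact_rec[of "M - j"] by (simp_all add: q_def)
    have u0: "u j = (of_int j + 1) * p * ((of_int M - of_int j + 1) * q)"
      by (simp add: u_def j0 M0[unfolded M_def] M_def)
    have um: "u (j - 1) = of_int j * ((of_int j + 1) * p) * q"
      using j1 by (simp add: u_def q_def M_def algebra_simps)
    have up: "u (j + 1) = p * ((of_int M - of_int j) * ((of_int M - of_int j + 1) * q))"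
    proof -
      have "n - int l - (j + 1) = M - j - 1" by (simp add: M_def)
      then show ?thesis by (simp only: u_def M1 p_def)
    qed
    have t0: "racah_term n l m a k = g * u j" and tm: "racah_term n l m (a - 1) k = g * u (j - 1)"
      and tp: "racah_term n l m (a + 1) k = g * u (j + 1)"
      by (simp_all add: racah_term_def g_def u_def j_def algebra_simps)
    have Gk: "G k = (of_int (int k) * (of_int (int k) - of_int m)) * g * (u (j + 1) + u j)"
    proof -
      have r: "rfact (int k - 1 - m) = (of_int (int k) - of_int m) * rfact (int k - m)"
        using rfact_rec[of "int k - m"] by (simp add: algebra_simps)
      have j: "a + 1 - int k = j + 1" "a - int k = j" by (simp_all add: j_def)
      show ?thesis unfolding G_def rfact_rec[of "int k"] r j g_def by simp
    qed
    have GS: "G (Suc k) = - (of_int (int l - int k) * of_int (int l + m - int k)) * g * (u j + u (j - 1))"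
    proof -
      have "rfact (int l - int (Suc k)) = of_int (int l - int k) * rfact (int l - int k)"
        "rfact (int l + m - int (Suc k)) = of_int (int l + m - int k) * rfact (int l + m - int k)"
        using rfact_rec[of "int l - int k"] rfact_rec[of "int l + m - int k"]
        by (simp_all add: algebra_simps)
      then have "G (Suc k) = (-1) ^ Suc k * rfact (int (Suc k) - 1)
          * (of_int (int l - int k) * rfact (int l - int k))
          * (of_int (int l + m - int k) * rfact (int l + m - int k)) * rfact (int (Suc k) - 1 - m)
          * (u (a + 1 - int (Suc k)) + u (a - int (Suc k)))"
        unfolding G_def by simp
      moreover have j: "a + 1 - int (Suc k) = j" "a - int (Suc k) = j - 1" "int (Suc k) - 1 = int k"
        by (simp_all add: j_def)
      ultimately show ?thesis unfolding j g_def by simp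
    qed
    define K L J R N' where "K = real k" and "L = real l" and "J = real_of_int j"
      and "R = real_of_int m" and "N' = real_of_int M"
    have ab: "real_of_int a = J + K" "real_of_int b = J + K - R" "real_of_int n = N' + L"
      by (simp_all add: j_def b_def M_def J_def K_def R_def N'_def L_def)
    have ll: "of_nat (l * (l + 1)) = L * (L + 1)" by (simp add: L_def algebra_simps)
    have "((N' + L) * (N' + L + 2) / 2 - 2 * (J + K - (N' + L) / 2) * (J + K - R - (N' + L) / 2)
          - L * (L + 1)) * (g * ((J + 1) * p * ((N' - J + 1) * q)))
        - ((N' + L - (J + K) + 1) * (N' + L - (J + K - R) + 1)) * (g * (J * ((J + 1) * p) * q))
        - ((J + K + 1) * (J + K - R + 1)) * (g * (p * ((N' - J) * ((N' - J + 1) * q))))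
      = - ((L - K) * (L + R - K)) * g * ((J + 1) * p * ((N' - J + 1) * q) + J * ((J + 1) * p) * q)
        - (K * (K - R)) * g * (p * ((N' - J) * ((N' - J + 1) * q)) + (J + 1) * p * ((N' - J + 1) * q))"
      by (simp add: field_simps)
    then show ?thesis
      unfolding t0 tm tp Gk GS u0 um up ll
      by (simp add: ab flip: J_def K_def R_def N'_def L_def)
  qed
  have "(\<Sum>k\<le>l. G (Suc k) - G k) = G (Suc l) - G 0"
    using sum_lessThan_telescope[of G "Suc l"] by (simp only: lessThan_Suc_atMost)
  also have "G (Suc l) = 0" by (simp add: G_def rfact_neg)
  also have "G 0 = 0" by (simp add: G_def rfact_neg)
  finally have "(\<Sum>k\<le>l. G (Suc k) - G k) = 0" by simp
  then show ?thesis
    unfolding step[symmetric] sum_subtractf sum_distrib_left[symmetric] racah_sum_def[symmetric]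
    by (simp add: algebra_simps)
qed

text \<open>At one end of the diagonal only one summand survives.\<close>

lemma racah_sum_nonzero:
  assumes l: "int l \<le> n" and m: "\<bar>m\<bar> \<le> int l"
  shows "racah_sum n l m (if m \<ge> 0 then n else 0) \<noteq> 0"
proof (cases "m \<ge> 0")
  case True
  have "racah_sum n l m n = racah_term n l m n l"
    unfolding racah_sum_def
    by (rule sum.mono_neutral_right[of "{..l}" "{l}", simplified]) (auto simp: racah_term_def rfact_neg)
  also have "\<dots> \<noteq> 0"
    using l m True rfact_pos[of "int l"] rfact_pos[of 0] rfact_pos[of m] rfact_pos[of "int l - m"]
      rfact_pos[of "n - int l"]
    by (auto simp: racah_term_def)
  finally show ?thesis using True by simp
next
  case False
  have "racah_sum n l m 0 = racah_term n l m 0 0"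
    unfolding racah_sum_def
    by (rule sum.mono_neutral_right[of "{..l}" "{0}", simplified]) (auto simp: racah_term_def rfact_neg)
  also have "\<dots> \<noteq> 0"
    using l m False rfact_pos[of "int l"] rfact_pos[of 0] rfact_pos[of "- m"] rfact_pos[of "int l + m"]
      rfact_pos[of "n - int l"]
    by (auto simp: racah_term_def)
  finally show ?thesis using False by simp
qed


section \<open>The matrices of the spherical basis\<close>

text \<open>
  The magnetic number shifted by \<open>s\<close>, so that rows and columns are numbered by \<open>0, \<dots>, N - 1\<close>.
  As an integer it has a predecessor and a successor also at the ends.
\<close>

definition level :: "'n::{finite,linorder} \<Rightarrow> int" where
  "level i = int (position i) - 1"

abbreviation top_level :: "'n::finite itself \<Rightarrow> int" where
  "top_level _ \<equiv> int CARD('n) - 1"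

lemma level_range: "0 \<le> level i" "level i \<le> top_level TYPE('n)" for i :: "'n::{finite,linorder}"
  using position_range[of i] by (simp_all add: level_def)

lemma level_inj: "level i = level j \<longleftrightarrow> i = j"
  by (simp add: level_def position_inj)

lemma level_surj:
  assumes "0 \<le> x" "x \<le> top_level TYPE('n)"
  obtains i :: "'n::{finite,linorder}" where "level i = x"
proof -
  have "nat (x + 1) \<in> {1..CARD('n)}" using assms by auto
  then obtain i :: 'n where "position i = nat (x + 1)"
    using bij_betw_imp_surj_on[OF bij_betw_position[where 'n = 'n]] by (metis imageE)
  then show thesis using assms by (intro that[of i]) (simp add: level_def)
qed

definition level_weight :: "int \<Rightarrow> int \<Rightarrow> real" where
  "level_weight n a = sqrt (fact (nat a) * fact (nat (n - a)))"

lemma fact_of_int: "fact_of (of_int x) = fact (nat x)"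
  by (simp add: fact_of_def)

lemma minus_one_powi_even: "(-1 :: real) powi (2 * x) = 1"
  by (simp add: power_int_mult)

text \<open>
  With the selection rules resolved, an entry of \<open>T_matrix l m\<close> is a constant times Racah's
  sum, weighted by square roots of factorials; both signs in the definition combine to the
  constant \<open>(-1)\<^bsup>l+m\<^esup>\<close>.
\<close>

lemma T_matrix_entries:
  assumes l: "l < CARD('n::{finite,linorder})" and m: "\<bar>m\<bar> \<le> int l"
  shows "\<exists>c. c \<noteq> 0 \<and> (\<forall>i j. (T_matrix l m :: 'n cmat) $ i $ j = of_real
    (if level i - level j = m
     then c * level_weight (top_level TYPE('n)) (level i) * level_weight (top_level TYPE('n)) (level j)
            * racah_sum (top_level TYPE('n)) l m (level i)
     else 0))"
proof -
  define n where "n = top_level TYPE('n)"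
  define s where "s = spin TYPE('n)"
  define tri where "tri = sqrt (fact l * fact (nat (n - int l)) * fact l / fact (nat (n + int l + 1)))"
  define lm where "lm = sqrt (fact (nat (int l - m)) * fact (nat (int l + m)))"
  define c where "c = sqrt (real CARD('n) / (4 * pi)) * (-1) powi (int l + m) * sqrt (2 * real l + 1)
    * tri * lm"
  have s2: "s + s = of_int n" by (simp add: s_def spin_def n_def)
  have "c \<noteq> 0" using l m by (simp add: c_def tri_def lm_def)
  moreover have "(T_matrix l m :: 'n cmat) $ i $ j = of_real
    (if level i - level j = m
     then c * level_weight n (level i) * level_weight n (level j) * racah_sum n l m (level i) else 0)" for i j
  proof -
    define a b where "a = level i" and "b = level j"
    have ra: "0 \<le> a" "a \<le> n" and rb: "0 \<le> b" "b \<le> n"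
      using level_range[of i] level_range[of j] by (simp_all add: a_def b_def n_def)
    have mi: "magnetic_number i = of_int a - s" and mj: "magnetic_number j = of_int b - s"
      by (simp_all add: magnetic_number_def a_def b_def level_def s_def)
    have rule: "- magnetic_number i + of_int m + magnetic_number j = 0 \<longleftrightarrow> a - b = m"
    proof -
      have "- magnetic_number i + of_int m + magnetic_number j = of_int (m - (a - b))"
        by (simp add: mi mj)
      then show ?thesis by (simp only: of_int_eq_0_iff) linarith
    qed
    have T: "(T_matrix l m :: 'n cmat) $ i $ j = complex_of_real
        (sqrt (real CARD('n) / (4 * pi)) * (-1) powi \<lfloor>s - magnetic_number i\<rfloor>
         * sqrt (2 * real l + 1)
         * wigner_3j s (real l) s (- magnetic_number i) (of_int m) (magnetic_number j))"
      by (simp add: T_matrix_def s_def Let_def)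
    show ?thesis
    proof (cases "a - b = m")
      case False
      then have "wigner_3j s (real l) s (- magnetic_number i) (of_int m) (magnetic_number j) = 0"
        using rule by (simp add: wigner_3j_def)
      then show ?thesis using False by (simp add: T a_def b_def)
    next
      case True
      have ar: "s + real l - s = of_int (int l)" "s - real l + s = of_int (n - int l)"
        "- s + real l + s = of_int (int l)" "s + real l + s + 1 = of_int (n + int l + 1)"
        "s - - magnetic_number i = of_int a" "s + - magnetic_number i = of_int (n - a)"
        "real l - of_int m = of_int (int l - m)" "real l + of_int m = of_int (int l + m)"
        "s - magnetic_number j = of_int (n - b)" "s + magnetic_number j = of_int b"
        using s2 by (simp_all add: mi mj)
      have ark: "of_int (int l) - real k = of_int (int l - int k)"
        "of_int a - real k = of_int (a - int k)"
        "of_int (int l + m) - real k = of_int (int l + m - int k)"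
        "s - real l + - magnetic_number i + real k = of_int (n - a - int l + int k)"
        "s - s - of_int m + real k = of_int (int k - m)" for k
        using s2 by (simp_all add: mi)
      have cond: "- magnetic_number i + of_int m + magnetic_number j = 0 \<and>
         (\<forall>(j, m) \<in> {(s, - magnetic_number i), (real l, of_int m), (s, magnetic_number j)}.
            j - m \<in> \<int> \<and> j + m \<in> \<int> \<and> \<bar>m\<bar> \<le> j) \<and>
         \<bar>s - real l\<bar> \<le> s \<and> s \<le> s + real l"
      proof -
        have "real_of_int 0 \<le> of_int a" "real_of_int a \<le> of_int n"
          "real_of_int 0 \<le> of_int b" "real_of_int b \<le> of_int n"
          using ra rb by (simp_all only: of_int_le_iff)
        then have "\<bar>magnetic_number i\<bar> \<le> s" "\<bar>magnetic_number j\<bar> \<le> s"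
          using s2 by (auto simp: mi mj abs_le_iff)
        moreover have "\<bar>of_int m\<bar> \<le> real l" using m by linarith
        moreover have "\<bar>s - real l\<bar> \<le> s"
        proof -
          have "real_of_int (int l) \<le> of_int n" using l by (simp add: n_def)
          then have "real l \<le> s + s" unfolding s2 by simp
          then show ?thesis by linarith
        qed
        moreover have "s - - magnetic_number i \<in> \<int>" "s + - magnetic_number i \<in> \<int>"
          "real l - of_int m \<in> \<int>" "real l + of_int m \<in> \<int>"
          "s - magnetic_number j \<in> \<int>" "s + magnetic_number j \<in> \<int>"
          unfolding ar by (rule Ints_of_int)+
        ultimately show ?thesis using rule True by simp
      qed
      define S where "S = {k::nat. real k \<le> s + real l - s \<and> real k \<le> s - - magnetic_number i \<and>
          real k \<le> real l + of_int m \<and> 0 \<le> s - real l + - magnetic_number i + real k \<and>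
          0 \<le> s - s - of_int m + real k}"
      have S: "S = {k. int k \<le> int l \<and> int k \<le> a \<and> int k \<le> int l + m \<and> 0 \<le> n - a - int l + int k
          \<and> 0 \<le> int k - m}"
      proof -
        have "real k \<le> of_int x \<longleftrightarrow> int k \<le> x" for k x by linarith
        then show ?thesis unfolding S_def ar ark by (simp only: of_int_0_le_iff)
      qed
      have sum: "(\<Sum>k\<in>S. (-1) ^ k
             / (fact k * fact_of (s + real l - s - real k) * fact_of (s - - magnetic_number i - real k)
                * fact_of (real l + of_int m - real k)
                * fact_of (s - real l + - magnetic_number i + real k)
                * fact_of (s - s - of_int m + real k))) = racah_sum n l m a"
        (is "?lhs = _")
      proof -
        have "?lhs = (\<Sum>k\<in>S. racah_term n l m a k)"
        proof (rule sum.cong[OF refl])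
          fix k assume "k \<in> S"
          then have "0 \<le> int l - int k" "0 \<le> a - int k" "0 \<le> int l + m - int k"
            "0 \<le> n - a - int l + int k" "0 \<le> int k - m"
            unfolding S by auto
          then show "(-1) ^ k
             / (fact k * fact_of (s + real l - s - real k) * fact_of (s - - magnetic_number i - real k)
                * fact_of (real l + of_int m - real k)
                * fact_of (s - real l + - magnetic_number i + real k)
                * fact_of (s - s - of_int m + real k)) = racah_term n l m a k"
            unfolding ar ark fact_of_int racah_term_def rfact_def
            by simp
        qed
        also have "\<dots> = racah_sum n l m a"
          unfolding racah_sum_def
          by (rule sum.mono_neutral_left) (auto simp: S racah_term_def rfact_def)
        finally show ?thesis .
      qed
      have "wigner_3j s (real l) s (- magnetic_number i) (of_int m) (magnetic_number j)
          = (-1) powi \<lfloor>s - real l - magnetic_number j\<rfloor>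
            * sqrt (fact_of (s + real l - s) * fact_of (s - real l + s) * fact_of (- s + real l + s)
                / fact_of (s + real l + s + 1))
            * sqrt (fact_of (s - - magnetic_number i) * fact_of (s + - magnetic_number i)
                * fact_of (real l - of_int m) * fact_of (real l + of_int m)
                * fact_of (s - magnetic_number j) * fact_of (s + magnetic_number j))
            * racah_sum n l m a"
        unfolding wigner_3j_def if_P[OF cond] S_def[symmetric] sum ..
      also have "\<lfloor>s - real l - magnetic_number j\<rfloor> = n - int l - b"
      proof -
        have "s - real l - magnetic_number j = of_int (n - int l - b)" using s2 by (simp add: mj)
        then show ?thesis by (simp only: floor_of_int)
      qed
      also have "sqrt (fact_of (s + real l - s) * fact_of (s - real l + s) * fact_of (- s + real l + s)
                / fact_of (s + real l + s + 1)) = tri"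
        unfolding ar fact_of_int tri_def by simp
      also have "sqrt (fact_of (s - - magnetic_number i) * fact_of (s + - magnetic_number i)
                * fact_of (real l - of_int m) * fact_of (real l + of_int m)
                * fact_of (s - magnetic_number j) * fact_of (s + magnetic_number j))
          = lm * level_weight n a * level_weight n b"
        unfolding ar fact_of_int lm_def level_weight_def by (simp add: real_sqrt_mult)
      finally have W: "wigner_3j s (real l) s (- magnetic_number i) (of_int m) (magnetic_number j)
          = (-1) powi (n - int l - b) * tri * (lm * level_weight n a * level_weight n b)
            * racah_sum n l m a" .
      have fl: "\<lfloor>s - magnetic_number i\<rfloor> = n - a"
      proof -
        have "s - magnetic_number i = of_int (n - a)" using s2 by (simp add: mi)
        then show ?thesis by (simp only: floor_of_int)
      qed
      have sign: "(-1 :: real) powi (n - a) * (-1) powi (n - int l - b) = (-1) powi (int l + m)"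
      proof -
        have "(-1 :: real) powi (n - a) * (-1) powi (n - int l - b)
            = (-1) powi ((n - a) + (n - int l - b))" by (rule power_int_add[symmetric]) simp
        also have "(n - a) + (n - int l - b) = (int l + m) + 2 * (n - int l - a)"
          using True by simp
        also have "(-1 :: real) powi \<dots> = (-1) powi (int l + m) * (-1) powi (2 * (n - int l - a))"
          by (rule power_int_add) simp
        also have "\<dots> = (-1) powi (int l + m)" by (simp only: minus_one_powi_even mult_1_right)
        finally show ?thesis .
      qed
      have "sqrt (real CARD('n) / (4 * pi)) * (-1) powi (n - a) * sqrt (2 * real l + 1)
          * ((-1) powi (n - int l - b) * tri * (lm * level_weight n a * level_weight n b) * racah_sum n l m a)
        = sqrt (real CARD('n) / (4 * pi)) * ((-1) powi (n - a) * (-1) powi (n - int l - b))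
          * sqrt (2 * real l + 1) * tri * lm * level_weight n a * level_weight n b * racah_sum n l m a"
        by (simp only: ac_simps)
      also have "\<dots> = c * level_weight n a * level_weight n b * racah_sum n l m a"
        unfolding sign c_def ..
      finally have const: "sqrt (real CARD('n) / (4 * pi)) * (-1) powi (n - a) * sqrt (2 * real l + 1)
          * ((-1) powi (n - int l - b) * tri * (lm * level_weight n a * level_weight n b) * racah_sum n l m a)
        = c * level_weight n a * level_weight n b * racah_sum n l m a" .
      show ?thesis
        unfolding T W fl const using True by (simp add: a_def b_def)
    qed
  qed
  ultimately show ?thesis unfolding n_def by blast
qed

lemma level_weight_pos: "level_weight n a > 0"
  by (simp add: level_weight_def)

lemma T_matrix_nonzero:
  assumes l: "l < CARD('n::{finite,linorder})" and m: "\<bar>m\<bar> \<le> int l"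
  shows "(T_matrix l m :: 'n cmat) \<noteq> 0"
proof -
  obtain c where c: "c \<noteq> 0" and T: "\<And>i j. (T_matrix l m :: 'n cmat) $ i $ j = of_real
    (if level i - level j = m
     then c * level_weight (top_level TYPE('n)) (level i) * level_weight (top_level TYPE('n)) (level j)
            * racah_sum (top_level TYPE('n)) l m (level i)
     else 0)"
    using T_matrix_entries[OF l m] by blast
  define x where "x = (if m \<ge> 0 then top_level TYPE('n) else 0)"
  obtain i :: 'n where i: "level i = x" by (rule level_surj[of x]) (auto simp: x_def)
  obtain j :: 'n where j: "level j = x - m" by (rule level_surj[of "x - m"]) (use l m in \<open>auto simp: x_def\<close>)
  have "racah_sum (top_level TYPE('n)) l m x \<noteq> 0"
    unfolding x_def using l m by (intro racah_sum_nonzero) auto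
  then have "(T_matrix l m :: 'n cmat) $ i $ j \<noteq> 0"
    using c level_weight_pos[of "top_level TYPE('n)"] by (simp add: T i j less_imp_neq[symmetric])
  then show ?thesis by auto
qed

section \<open>The Laplacian as a Casimir operator\<close>

text \<open>
  The spin operators of the \<open>N\<close>-dimensional irreducible representation of \<open>su(2)\<close>:  \<open>S\<^sub>z\<close> is
  diagonal, \<open>S\<^sub>+\<close> raises the level by one, and \<open>S\<^sub>- = S\<^sub>+\<^sup>*\<close>.
\<close>

definition spin_z :: "('n::{finite,linorder}) cmat" where
  "spin_z = (\<chi> i j. if i = j then of_int (level i) - of_int (top_level TYPE('n)) / 2 else 0)"

definition spin_raise :: "('n::{finite,linorder}) cmat" where
  "spin_raise = (\<chi> i j. if level i = level j + 1
     then of_real (sqrt (of_int (level i * (top_level TYPE('n) - level i + 1)))) else 0)"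

text \<open>
  This is \<open>- \<Sum>\<^sub>a [S\<^sub>a, [S\<^sub>a, X]]\<close>, \<open>a = x, y, z\<close>, multiplied out by means of
  \<open>S\<^sub>x\<^sup>2 + S\<^sub>y\<^sup>2 + S\<^sub>z\<^sup>2 = s (s + 1)\<close> and \<open>2 (S\<^sub>x X S\<^sub>x + S\<^sub>y X S\<^sub>y) = S\<^sub>+ X S\<^sub>- + S\<^sub>- X S\<^sub>+\<close>.
\<close>

definition casimir :: "('n::{finite,linorder}) cmat \<Rightarrow> 'n cmat" where
  "casimir X = 2 *\<^sub>R (spin_z ** X ** spin_z) + spin_raise ** X ** adj spin_raise
     + adj spin_raise ** X ** spin_raise
     - (of_int (top_level TYPE('n) * (top_level TYPE('n) + 2)) / 2) *\<^sub>R X"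

lemma adj_spin_z [simp]: "adj spin_z = spin_z"
  by (simp add: vec_eq_iff spin_z_def)

lemma casimir_adj: "casimir (adj X) = adj (casimir X)"
  by (simp add: casimir_def adj_mult matrix_mul_assoc)

lemma casimir_symmetric: "inner (casimir X) Y = inner X (casimir Y)"
proof -
  have "inner (A ** X ** B) Y = inner X (adj A ** Y ** adj B)" for A B :: "'a cmat"
    by (subst inner_mult_right, subst inner_mult_left) (simp add: matrix_mul_assoc)
  note this[of spin_z spin_z] this[of spin_raise "adj spin_raise"] this[of "adj spin_raise" spin_raise]
  then show ?thesis
    unfolding casimir_def by (simp add: inner_add_left inner_diff_left inner_add_right inner_diff_right)
qed

lemma sum_level_shift:
  fixes f :: "int \<Rightarrow> 'a::comm_monoid_add" and d :: int
  shows "(\<Sum>k\<in>UNIV. if level (k :: 'n::{finite,linorder}) = x then f (level k) else 0)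
    = (if 0 \<le> x \<and> x \<le> top_level TYPE('n) then f x else 0)"
proof (cases "0 \<le> x \<and> x \<le> top_level TYPE('n)")
  case True
  then obtain i :: 'n where i: "level i = x" by (meson level_surj)
  then have "(\<Sum>k\<in>UNIV. if level (k :: 'n) = x then f (level k) else 0)
      = (\<Sum>k\<in>UNIV. if k = i then f x else 0)"
    by (intro sum.cong) (auto simp: level_inj)
  then show ?thesis using True by simp
next
  case False
  then have "level (k :: 'n) \<noteq> x" for k using level_range[of k] by auto
  then show ?thesis using False by auto
qed

text \<open>
  On every diagonal of the matrix the operator acts by three terms.  The entries are given by a
  function \<open>F\<close> of arbitrary integers: where a neighbour lies outside the matrix, one of the square
  roots in front of it is \<open>0\<close>.
\<close>

lemma casimir_nth:
  fixes F :: "int \<Rightarrow> int \<Rightarrow> real" and i j :: "'n::{finite,linorder}"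
  defines "n \<equiv> top_level TYPE('n)" and "a \<equiv> level i" and "b \<equiv> level j"
  shows "casimir (\<chi> i j. of_real (F (level i) (level j))) $ i $ j = of_real
    (2 * (of_int a - of_int n / 2) * (of_int b - of_int n / 2) * F a b
     + sqrt (of_int (a * (n - a + 1))) * sqrt (of_int (b * (n - b + 1))) * F (a - 1) (b - 1)
     + sqrt (of_int ((a + 1) * (n - a))) * sqrt (of_int ((b + 1) * (n - b))) * F (a + 1) (b + 1)
     - of_int (n * (n + 2)) / 2 * F a b)"
proof -
  have ra: "0 \<le> a" "a \<le> n" and rb: "0 \<le> b" "b \<le> n"
    using level_range[of i] level_range[of j] by (simp_all add: a_def b_def n_def)
  let ?X = "(\<chi> i j. of_real (F (level i) (level j))) :: 'n cmat"
  have zXz: "(spin_z ** ?X ** spin_z) $ i $ j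
      = of_real ((of_int a - of_int n / 2) * (of_int b - of_int n / 2) * F a b)"
    by (simp add: matrix_matrix_mult_def spin_z_def if_distrib[where f="\<lambda>x. x * _"]
        if_distrib[where f="\<lambda>x. _ * x"] a_def b_def n_def cong: if_cong)
  have up: "(spin_raise ** ?X) $ i $ j = of_real (sqrt (of_int (level i * (n - level i + 1)))
      * F (level i - 1) (level j))" for i j
  proof -
    have "(spin_raise ** ?X) $ i $ j = (\<Sum>k\<in>UNIV. if level (k :: 'n) = level i - 1 then
        of_real (sqrt (of_int (level i * (n - level i + 1))) * F (level k) (level j)) else 0)"
      unfolding matrix_matrix_mult_def spin_raise_def n_def adj_nth vec_lambda_beta
      by (intro sum.cong refl) auto
    also have "\<dots> = (if 0 \<le> level i - 1 \<and> level i - 1 \<le> top_level TYPE('n) then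
        of_real (sqrt (of_int (level i * (n - level i + 1))) * F (level i - 1) (level j)) else 0)"
      by (rule sum_level_shift)
    finally show ?thesis using level_range[of i] by (auto simp: n_def)
  qed
  have down: "(adj spin_raise ** ?X) $ i $ j = of_real (sqrt (of_int ((level i + 1) * (n - level i)))
      * F (level i + 1) (level j))" for i j
  proof -
    have "(adj spin_raise ** ?X) $ i $ j = (\<Sum>k\<in>UNIV. if level (k :: 'n) = level i + 1 then
        of_real (sqrt (of_int ((level i + 1) * (n - level i))) * F (level k) (level j)) else 0)"
      unfolding matrix_matrix_mult_def spin_raise_def n_def adj_nth vec_lambda_beta
      by (intro sum.cong refl) auto
    also have "\<dots> = (if 0 \<le> level i + 1 \<and> level i + 1 \<le> top_level TYPE('n) then
        of_real (sqrt (of_int ((level i + 1) * (n - level i))) * F (level i + 1) (level j)) else 0)"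
      by (rule sum_level_shift)
    finally show ?thesis using level_range[of i] by (auto simp: n_def)
  qed
  have "(spin_raise ** ?X ** adj spin_raise) $ i $ j = (\<Sum>k\<in>UNIV. if level (k :: 'n) = b - 1 then
      of_real (sqrt (of_int (a * (n - a + 1))) * sqrt (of_int (b * (n - b + 1)))
        * F (a - 1) (level k)) else 0)"
    unfolding matrix_matrix_mult_def[of "spin_raise ** ?X"] vec_lambda_beta up
    by (intro sum.cong refl) (auto simp: spin_raise_def n_def a_def b_def)
  also have "\<dots> = (if 0 \<le> b - 1 \<and> b - 1 \<le> top_level TYPE('n) then
      of_real (sqrt (of_int (a * (n - a + 1))) * sqrt (of_int (b * (n - b + 1)))
        * F (a - 1) (b - 1)) else 0)"
    by (rule sum_level_shift)
  finally have upup: "(spin_raise ** ?X ** adj spin_raise) $ i $ j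
      = of_real (sqrt (of_int (a * (n - a + 1))) * sqrt (of_int (b * (n - b + 1))) * F (a - 1) (b - 1))"
    using rb by (auto simp: n_def)
  have "(adj spin_raise ** ?X ** spin_raise) $ i $ j = (\<Sum>k\<in>UNIV. if level (k :: 'n) = b + 1 then
      of_real (sqrt (of_int ((a + 1) * (n - a))) * sqrt (of_int ((b + 1) * (n - b)))
        * F (a + 1) (level k)) else 0)"
    unfolding matrix_matrix_mult_def[of "adj spin_raise ** ?X"] vec_lambda_beta down
    by (intro sum.cong refl) (auto simp: spin_raise_def n_def a_def b_def)
  also have "\<dots> = (if 0 \<le> b + 1 \<and> b + 1 \<le> top_level TYPE('n) then
      of_real (sqrt (of_int ((a + 1) * (n - a))) * sqrt (of_int ((b + 1) * (n - b)))
        * F (a + 1) (b + 1)) else 0)"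
    by (rule sum_level_shift)
  finally have downdown: "(adj spin_raise ** ?X ** spin_raise) $ i $ j
      = of_real (sqrt (of_int ((a + 1) * (n - a))) * sqrt (of_int ((b + 1) * (n - b))) * F (a + 1) (b + 1))"
    using rb by (auto simp: n_def)
  show ?thesis
    unfolding casimir_def vector_add_component vector_minus_component vector_scaleR_component
      zXz upup downdown
    by (simp add: scaleR_conv_of_real a_def b_def n_def)
qed

text \<open>
  The square roots of the ladder operators combine with the weights to the polynomial
  coefficients of the recurrence for Racah's sum.
\<close>

lemma level_weight_shift:
  assumes "0 < a" "a \<le> n"
  shows "sqrt (of_int (a * (n - a + 1))) * level_weight n (a - 1) = of_int (n - a + 1) * level_weight n a"
    and "sqrt (of_int (a * (n - a + 1))) * level_weight n a = of_int a * level_weight n (a - 1)"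
proof -
  have f1: "fact (nat a) = of_int a * (fact (nat (a - 1)) :: real)"
  proof -
    have "nat a = Suc (nat (a - 1))" using assms by simp
    then show ?thesis using assms by (simp only: fact_Suc) simp
  qed
  have f2: "fact (nat (n - (a - 1))) = of_int (n - a + 1) * (fact (nat (n - a)) :: real)"
  proof -
    have "nat (n - (a - 1)) = Suc (nat (n - a))" using assms by simp
    then show ?thesis using assms by (simp only: fact_Suc) simp
  qed
  have "sqrt (of_int (a * (n - a + 1))) * level_weight n (a - 1)
      = sqrt ((of_int (n - a + 1))\<^sup>2 * (fact (nat a) * fact (nat (n - a))))"
    unfolding level_weight_def f1 f2 real_sqrt_mult[symmetric]
    by (simp add: power2_eq_square algebra_simps)
  also have "\<dots> = of_int (n - a + 1) * level_weight n a"
    using assms by (simp add: real_sqrt_mult level_weight_def)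
  finally show "sqrt (of_int (a * (n - a + 1))) * level_weight n (a - 1)
      = of_int (n - a + 1) * level_weight n a" .
  have "sqrt (of_int (a * (n - a + 1))) * level_weight n a
      = sqrt ((of_int a)\<^sup>2 * (fact (nat (a - 1)) * fact (nat (n - (a - 1)))))"
    unfolding level_weight_def f1 f2 real_sqrt_mult[symmetric]
    by (simp add: power2_eq_square algebra_simps)
  also have "\<dots> = of_int a * level_weight n (a - 1)"
    using assms by (simp add: real_sqrt_mult level_weight_def)
  finally show "sqrt (of_int (a * (n - a + 1))) * level_weight n a = of_int a * level_weight n (a - 1)" .
qed

text \<open>
  After division by the weights, the eigenvalue equation on the diagonal \<open>a - b = m\<close> is the
  three-term recurrence for Racah's sum.
\<close>

theorem casimir_T_matrix:
  assumes l: "l < CARD('n::{finite,linorder})" and m: "\<bar>m\<bar> \<le> int l"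
  shows "casimir (T_matrix l m :: 'n cmat) = (- real (l * (l + 1))) *\<^sub>R T_matrix l m"
proof -
  define n where "n = top_level TYPE('n)"
  define Q where "Q = racah_sum n l m"
  define w where "w = level_weight n"
  obtain c where c: "c \<noteq> 0" and T: "\<And>i j. (T_matrix l m :: 'n cmat) $ i $ j = of_real
    (if level i - level j = m then c * w (level i) * w (level j) * Q (level i) else 0)"
    using T_matrix_entries[OF l m] unfolding n_def w_def Q_def by blast
  define F where "F a b = (if a - b = m then c * w a * w b * Q a else 0)" for a b
  have TF: "(T_matrix l m :: 'n cmat) = (\<chi> i j. of_real (F (level i) (level j)))"
    by (simp add: vec_eq_iff T F_def)
  have "casimir (T_matrix l m) $ i $ j = (- real (l * (l + 1))) *\<^sub>R (T_matrix l m :: 'n cmat) $ i $ j"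
    for i j :: 'n
  proof -
    define a b where "a = level i" and "b = level j"
    have ra: "0 \<le> a" "a \<le> n" and rb: "0 \<le> b" "b \<le> n"
      using level_range[of i] level_range[of j] by (simp_all add: a_def b_def n_def)
    have "2 * (of_int a - of_int n / 2) * (of_int b - of_int n / 2) * F a b
     + sqrt (of_int (a * (n - a + 1))) * sqrt (of_int (b * (n - b + 1))) * F (a - 1) (b - 1)
     + sqrt (of_int ((a + 1) * (n - a))) * sqrt (of_int ((b + 1) * (n - b))) * F (a + 1) (b + 1)
     - of_int (n * (n + 2)) / 2 * F a b = - real (l * (l + 1)) * F a b"
    proof (cases "a - b = m")
      case True
      then have b: "b = a - m" by simp
      have d: "sqrt (of_int (a * (n - a + 1))) * sqrt (of_int (b * (n - b + 1))) * F (a - 1) (b - 1)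
          = c * w a * w b * (of_int ((n - a + 1) * (n - b + 1)) * Q (a - 1))"
      proof (cases "a = 0 \<or> b = 0")
        case True
        then have "Q (a - 1) = 0" unfolding Q_def by (intro racah_sum_outside) (auto simp: b)
        then show ?thesis by (simp add: F_def)
      next
        case False
        then have pos: "0 < a" "0 < b" using ra rb by auto
        have "sqrt (of_int (a * (n - a + 1))) * sqrt (of_int (b * (n - b + 1))) * F (a - 1) (b - 1)
          = c * (sqrt (of_int (a * (n - a + 1))) * w (a - 1))
              * (sqrt (of_int (b * (n - b + 1))) * w (b - 1)) * Q (a - 1)"
          using True by (simp add: F_def)
        then show ?thesis
          unfolding w_def level_weight_shift(1)[OF pos(1) ra(2)] level_weight_shift(1)[OF pos(2) rb(2)]
          by simp
      qed
      have u: "sqrt (of_int ((a + 1) * (n - a))) * sqrt (of_int ((b + 1) * (n - b))) * F (a + 1) (b + 1)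
          = c * w a * w b * (of_int ((a + 1) * (b + 1)) * Q (a + 1))"
      proof (cases "a = n \<or> b = n")
        case True
        then have "Q (a + 1) = 0" unfolding Q_def by (intro racah_sum_outside) (auto simp: b)
        then show ?thesis by (simp add: F_def)
      next
        case False
        then have pos: "0 < a + 1" "a + 1 \<le> n" "0 < b + 1" "b + 1 \<le> n" using ra rb by auto
        have "sqrt (of_int ((a + 1) * (n - a))) * w (a + 1) = of_int (a + 1) * w a"
          "sqrt (of_int ((b + 1) * (n - b))) * w (b + 1) = of_int (b + 1) * w b"
          using level_weight_shift(2)[OF pos(1,2)] level_weight_shift(2)[OF pos(3,4)]
          by (simp_all add: w_def)
        moreover have "sqrt (of_int ((a + 1) * (n - a))) * sqrt (of_int ((b + 1) * (n - b))) * F (a + 1) (b + 1)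
          = c * (sqrt (of_int ((a + 1) * (n - a))) * w (a + 1))
              * (sqrt (of_int ((b + 1) * (n - b))) * w (b + 1)) * Q (a + 1)"
          using True by (simp add: F_def)
        ultimately show ?thesis by simp
      qed
      have collect: "2 * p * q * (k * Qa) + k * x + k * y - z * (k * Qa)
          = - k * ((z - 2 * p * q) * Qa - x - y)" for p q k Qa x y z :: real
        by (simp add: algebra_simps)
      have F: "F a b = c * w a * w b * Q a" using True by (simp add: F_def)
      have rec: "(of_int (n * (n + 2)) / 2 - 2 * (of_int a - of_int n / 2) * (of_int b - of_int n / 2)) * Q a
          - of_int ((n - a + 1) * (n - b + 1)) * Q (a - 1)
          - of_int ((a + 1) * (b + 1)) * Q (a + 1) = of_nat (l * (l + 1)) * Q a"
        using racah_sum_recurrence[of n a m l] unfolding Q_def b .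
      have "2 * (of_int a - of_int n / 2) * (of_int b - of_int n / 2) * F a b
         + sqrt (of_int (a * (n - a + 1))) * sqrt (of_int (b * (n - b + 1))) * F (a - 1) (b - 1)
         + sqrt (of_int ((a + 1) * (n - a))) * sqrt (of_int ((b + 1) * (n - b))) * F (a + 1) (b + 1)
         - of_int (n * (n + 2)) / 2 * F a b
        = - (c * w a * w b) * ((of_int (n * (n + 2)) / 2
            - 2 * (of_int a - of_int n / 2) * (of_int b - of_int n / 2)) * Q a
          - of_int ((n - a + 1) * (n - b + 1)) * Q (a - 1)
          - of_int ((a + 1) * (b + 1)) * Q (a + 1))"
        unfolding d u F by (rule collect)
      also have "\<dots> = - real (l * (l + 1)) * F a b" unfolding rec F by (simp add: algebra_simps)
      finally show ?thesis .
    qed (simp add: F_def)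
    note eigen = this
    show ?thesis
      unfolding TF casimir_nth[of F] n_def[symmetric] a_def[symmetric] b_def[symmetric] eigen
      by (simp only: vec_lambda_beta scaleR_conv_of_real of_real_mult a_def b_def)
  qed
  then show ?thesis by (simp add: vec_eq_iff)
qed


section \<open>Completeness of the spherical basis\<close>

lemma cscale_nth [simp]: "cscale c A $ i $ j = c * A $ i $ j"
  by (simp add: cscale_def)

lemma vector_space_cscale: "vector_space (cscale :: complex \<Rightarrow> ('n::finite) cmat \<Rightarrow> 'n cmat)"
  by standard (simp_all add: vec_eq_iff algebra_simps)

lemma scaleR_eq_cscale: "x *\<^sub>R A = cscale (of_real x) A" for A :: "('n::finite) cmat"
  by (simp add: vec_eq_iff) (simp add: scaleR_conv_of_real)

lemma norm_cscale: "norm (cscale c A) = cmod c * norm A" for A :: "('n::finite) cmat"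
proof -
  have "(norm (cscale c A))\<^sup>2 = (cmod c * norm A)\<^sup>2"
    unfolding norm_cmat_squared power_mult_distrib
    by (simp add: norm_mult power_mult_distrib sum_distrib_left)
  then show ?thesis by (simp add: power2_eq_iff_nonneg)
qed

lemma trace_cscale: "trace (cscale c A) = c * trace A"
  by (simp add: trace_def sum_distrib_left)

lemma casimir_linear: "Vector_Spaces.linear cscale cscale casimir"
proof -
  have 1: "A ** cscale c X ** B = cscale c (A ** X ** B)" for A B X :: "'a cmat" and c
    by (simp add: vec_eq_iff matrix_matrix_mult_def sum_distrib_left sum_distrib_right ac_simps)
  have 2: "cscale c (X + Y) = cscale c X + cscale c Y" "cscale c (X - Y) = cscale c X - cscale c Y"
    "x *\<^sub>R cscale c X = cscale c (x *\<^sub>R X)" for c x and X Y :: "'a cmat"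
    by (simp_all add: vec_eq_iff algebra_simps)
  show ?thesis
    unfolding Vector_Spaces.linear_iff
    using vector_space_cscale
    by (simp add: casimir_def 1 2 matrix_ring_simps scaleR_add_right)
qed

definition spherical_indices :: "nat \<Rightarrow> (nat \<times> int) set" where
  "spherical_indices N = (SIGMA l:{..<N}. {- int l..int l})"

lemma finite_spherical_indices: "finite (spherical_indices N)"
  by (simp add: spherical_indices_def)

lemma card_spherical_indices: "card (spherical_indices N) = N * N"
proof -
  have "card (spherical_indices N) = (\<Sum>l<N. 2 * l + 1)"
    unfolding spherical_indices_def by (subst card_SigmaI) (auto intro!: sum.cong)
  also have "\<dots> = N * N" by (induction N) auto
  finally show ?thesis .
qed

abbreviation T_at :: "nat \<times> int \<Rightarrow> ('n::{finite,linorder}) cmat" where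
  "T_at p \<equiv> T_matrix (fst p) (snd p)"

lemma spherical_indicesD:
  assumes "p \<in> spherical_indices N"
  shows "fst p < N" "\<bar>snd p\<bar> \<le> int (fst p)"
  using assms by (auto simp: spherical_indices_def)

lemma T_matrix_real: "(T_matrix l m :: ('n::{finite,linorder}) cmat) $ i $ j = of_real (Re (T_matrix l m $ i $ j))"
  unfolding T_matrix_def Let_def vec_lambda_beta Re_complex_of_real ..

text \<open>
  Different \<open>m\<close> have disjoint supports; equal \<open>m\<close> and different \<open>l\<close> are eigenvectors of a
  symmetric operator for different eigenvalues.
\<close>

lemma T_at_orthogonal:
  assumes p: "p \<in> spherical_indices CARD('n::{finite,linorder})"
    and q: "q \<in> spherical_indices CARD('n)" and ne: "p \<noteq> q"
  shows "orthogonal (cscale c (T_at p :: 'n cmat)) (cscale d (T_at q))"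
proof -
  note pD = spherical_indicesD[OF p] and qD = spherical_indicesD[OF q]
  have zero: "inner (T_at p :: 'n cmat) (T_at q) = 0"
  proof (cases "snd p = snd q")
    case True
    have "(- real (fst p * (fst p + 1))) * inner (T_at p :: 'n cmat) (T_at q)
        = inner (casimir (T_at p)) (T_at q :: 'n cmat)"
      by (simp only: casimir_T_matrix[OF pD] inner_scaleR_left)
    also have "\<dots> = inner (T_at p) (casimir (T_at q :: 'n cmat))" by (rule casimir_symmetric)
    also have "\<dots> = (- real (fst q * (fst q + 1))) * inner (T_at p :: 'n cmat) (T_at q)"
      by (simp only: casimir_T_matrix[OF qD] inner_scaleR_right)
    finally have eq: "(- real (fst p * (fst p + 1))) * inner (T_at p :: 'n cmat) (T_at q)
        = (- real (fst q * (fst q + 1))) * inner (T_at p :: 'n cmat) (T_at q)" .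
    have "fst p \<noteq> fst q" using True ne by (simp add: prod_eq_iff)
    then have "fst p * (fst p + 1) \<noteq> fst q * (fst q + 1)"
      by (metis add_right_cancel less_irrefl linorder_neqE_nat mult_strict_mono' add_less_cancel_right zero_le)
    then have "real (fst p * (fst p + 1)) \<noteq> real (fst q * (fst q + 1))" by (simp only: of_nat_eq_iff not_False_eq_True)
    then show ?thesis using eq by simp
  next
    case False
    have "cnj ((T_at p :: 'n cmat) $ i $ j) * (T_at q :: 'n cmat) $ i $ j = 0" for i j
      using T_matrix_entries[OF pD] T_matrix_entries[OF qD] False by auto
    then show ?thesis unfolding inner_cmat by (simp only:) simp
  qed
  have "inner (cscale c (T_at p :: 'n cmat)) (cscale d (T_at q))
      = Re (cnj c * d * of_real (inner (T_at p :: 'n cmat) (T_at q)))"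
  proof -
    have entry: "Re (cnj (cscale c (T_at p :: 'n cmat) $ i $ j) * cscale d (T_at q :: 'n cmat) $ i $ j)
      = Re (cnj c * d) * Re (cnj ((T_at p :: 'n cmat) $ i $ j) * (T_at q :: 'n cmat) $ i $ j)" for i j
      by (simp only: cscale_nth, subst (1 3) T_matrix_real, subst (2 4) T_matrix_real)
         (simp add: algebra_simps)
    show ?thesis unfolding inner_cmat entry
      by (simp add: sum_distrib_left)
  qed
  then show ?thesis using zero by (simp add: orthogonal_def)
qed

lemma norm_spherical_sum:
  assumes "J \<subseteq> spherical_indices CARD('n::{finite,linorder})"
  shows "(norm (\<Sum>p\<in>J. cscale (c p) (T_at p :: 'n cmat)))\<^sup>2
    = (\<Sum>p\<in>J. (cmod (c p))\<^sup>2 * (norm (T_at p :: 'n cmat))\<^sup>2)"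
proof -
  have "finite J" using assms finite_spherical_indices by (rule finite_subset)
  then have "(norm (\<Sum>p\<in>J. cscale (c p) (T_at p :: 'n cmat)))\<^sup>2
      = (\<Sum>p\<in>J. (norm (cscale (c p) (T_at p :: 'n cmat)))\<^sup>2)"
    by (rule norm_sum_Pythagorean) (use assms in \<open>auto simp: pairwise_def intro!: T_at_orthogonal\<close>)
  then show ?thesis by (simp add: norm_cscale power_mult_distrib)
qed

lemma T_at_nonzero:
  assumes "p \<in> spherical_indices CARD('n::{finite,linorder})"
  shows "(T_at p :: 'n cmat) \<noteq> 0"
  using T_matrix_nonzero spherical_indicesD[OF assms] by blast

text \<open>
  The \<open>N\<^sup>2\<close> matrices are nonzero and orthogonal, hence independent.  If \<open>X\<close> were outside their
  span, adding it would give \<open>N\<^sup>2 + 1\<close> independent matrices in the span of the \<open>N\<^sup>2\<close> matrix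
  units.
\<close>

theorem spherical_expansion:
  fixes X :: "('n::{finite,linorder}) cmat"
  obtains c where "X = (\<Sum>p\<in>spherical_indices CARD('n). cscale (c p) (T_at p))"
proof -
  interpret cs: vector_space "cscale :: complex \<Rightarrow> 'n cmat \<Rightarrow> 'n cmat"
    by (rule vector_space_cscale)
  define I where "I = spherical_indices CARD('n)"
  define B where "B = (T_at ` I :: 'n cmat set)"
  have finI: "finite I" by (simp add: I_def finite_spherical_indices)
  have inj: "inj_on (T_at :: _ \<Rightarrow> 'n cmat) I"
  proof (rule inj_onI, rule ccontr)
    fix p q assume "p \<in> I" "q \<in> I" and eq: "(T_at p :: 'n cmat) = T_at q" and ne: "p \<noteq> q"
    then have "orthogonal (cscale 1 (T_at p :: 'n cmat)) (cscale 1 (T_at q))"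
      unfolding I_def by (intro T_at_orthogonal)
    then have "(T_at p :: 'n cmat) = 0" by (simp add: orthogonal_def eq)
    then show False using T_at_nonzero \<open>p \<in> I\<close> unfolding I_def by blast
  qed
  have finB: "finite B" using finI by (simp add: B_def)
  have indep: "cs.independent B"
  proof (rule cs.independent_if_scalars_zero[OF finB])
    fix f x assume "(\<Sum>x\<in>B. cscale (f x) x) = 0" and "x \<in> B"
    then obtain p where p: "p \<in> I" "x = T_at p" by (auto simp: B_def)
    have "(\<Sum>p\<in>I. cscale (f (T_at p)) (T_at p :: 'n cmat)) = 0"
      using \<open>(\<Sum>x\<in>B. cscale (f x) x) = 0\<close> unfolding B_def sum.reindex[OF inj] by simp
    then have "(\<Sum>p\<in>I. (cmod (f (T_at p :: 'n cmat)))\<^sup>2 * (norm (T_at p :: 'n cmat))\<^sup>2) = 0"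
      using norm_spherical_sum[of I "\<lambda>p. f (T_at p)", where 'n = 'n] by (simp add: I_def)
    then have "(cmod (f (T_at p :: 'n cmat)))\<^sup>2 * (norm (T_at p :: 'n cmat))\<^sup>2 = 0"
      using p(1) finI by (subst (asm) sum_nonneg_eq_0_iff) auto
    then show "f x = 0" using T_at_nonzero[OF p(1)[unfolded I_def]] p(2) by simp
  qed
  define E where "E = (\<lambda>(a, b). \<chi> i j. if a = i \<and> b = j then 1 else (0 :: complex)) ` (UNIV :: ('n \<times> 'n) set)"
  have E_span: "Z \<in> cs.span E" for Z
  proof -
    have "Z = (\<Sum>a\<in>UNIV. \<Sum>b\<in>UNIV. cscale (Z $ a $ b) (\<chi> i j. if a = i \<and> b = j then 1 else 0))"
    proof -
      have "(\<Sum>b\<in>UNIV. Z $ a $ b * (if a = i \<and> b = j then 1 else 0)) = (if a = i then Z $ i $ j else 0)"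
        for a i j
        by (cases "a = i") (simp_all add: if_distrib[where f="\<lambda>x. _ * x"] cong: if_cong)
      then show ?thesis by (simp add: vec_eq_iff)
    qed
    also have "\<dots> \<in> cs.span E"
      by (intro cs.span_sum cs.span_scale cs.span_base) (force simp: E_def)
    finally show ?thesis .
  qed
  have card_E: "card E \<le> CARD('n) * CARD('n)"
    unfolding E_def by (rule order_trans[OF card_image_le]) simp_all
  have "X \<in> cs.span B"
  proof (rule ccontr)
    assume X: "X \<notin> cs.span B"
    then have "cs.independent (insert X B)" using indep by (rule cs.independent_insertI)
    then have "card (insert X B) \<le> card E"
      using cs.independent_span_bound[of E "insert X B"] E_span by (auto simp: E_def)
    moreover have "X \<notin> B" using X cs.span_base by blast
    ultimately have "Suc (card B) \<le> CARD('n) * CARD('n)" using finB card_E by simp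
    moreover have "card B = CARD('n) * CARD('n)"
      using card_image[OF inj] card_spherical_indices[of "CARD('n)"] by (simp add: B_def I_def)
    ultimately show False by simp
  qed
  then obtain u where "X = (\<Sum>v\<in>B. cscale (u v) v)"
    unfolding cs.span_finite[OF finB] by blast
  then have "X = (\<Sum>p\<in>I. cscale (u (T_at p)) (T_at p))"
    unfolding B_def sum.reindex[OF inj] by simp
  then show thesis unfolding I_def by (rule that)
qed

lemma casimir_cscale: "casimir (cscale c X) = cscale c (casimir X)"
  and casimir_sum: "casimir (\<Sum>p\<in>J. f p) = (\<Sum>p\<in>J. casimir (f p))"
  and casimir_diff: "casimir (X - Y) = casimir X - casimir Y"
proof -
  interpret Vector_Spaces.linear cscale cscale "casimir :: 'a cmat \<Rightarrow> 'a cmat" by (rule casimir_linear)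
  show "casimir (cscale c X) = cscale c (casimir X)" by (rule scale)
  show "casimir (X - Y) = casimir X - casimir Y" by (rule diff)
qed (use Vector_Spaces.linear_def casimir_linear module_hom.sum in blast)

lemma casimir_T_at:
  assumes "p \<in> spherical_indices CARD('n::{finite,linorder})"
  shows "casimir (T_at p :: 'n cmat) = cscale (- of_nat (fst p * (fst p + 1))) (T_at p)"
  using casimir_T_matrix[OF spherical_indicesD[OF assms]] by (simp add: scaleR_eq_cscale)

text \<open>
  The eigenvalue equations determine a linear map because the \<open>T_matrix l m\<close> span.  The explicit
  form of the map makes its symmetry and its behaviour under the adjoint visible.
\<close>

lemma discrete_laplacian_eq_casimir: "discrete_laplacian = (casimir :: ('n::{finite,linorder}) cmat \<Rightarrow> _)"
  unfolding discrete_laplacian_def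
proof (rule the_equality)
  show "Vector_Spaces.linear cscale cscale (casimir :: 'n cmat \<Rightarrow> _) \<and>
    (\<forall>l<CARD('n). \<forall>m\<in>{- int l..int l}.
      casimir (T_matrix l m :: 'n cmat) = cscale (- of_nat (l * (l + 1))) (T_matrix l m))"
    using casimir_linear casimir_T_at[of "(_, _)", where 'n = 'n] by (auto simp: spherical_indices_def)
next
  fix D :: "'n cmat \<Rightarrow> 'n cmat"
  assume D: "Vector_Spaces.linear cscale cscale D \<and>
    (\<forall>l<CARD('n). \<forall>m\<in>{- int l..int l}. D (T_matrix l m) = cscale (- of_nat (l * (l + 1))) (T_matrix l m))"
  then interpret D: Vector_Spaces.linear cscale cscale D by blast
  show "D = casimir"
  proof
    fix X :: "'n cmat"
    obtain c where X: "X = (\<Sum>p\<in>spherical_indices CARD('n). cscale (c p) (T_at p))"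
      by (rule spherical_expansion)
    have "D (T_at p) = casimir (T_at p)" if "p \<in> spherical_indices CARD('n)" for p
      using D that casimir_T_at[OF that] by (auto simp: spherical_indices_def)
    then show "D X = casimir X"
      unfolding X by (simp add: D.sum D.scale casimir_sum casimir_cscale)
  qed
qed

section \<open>The inverse Laplacian\<close>

lemma T_matrix_0_0: "\<exists>c. c \<noteq> 0 \<and> T_matrix 0 0 = cscale c (mat 1 :: ('n::{finite,linorder}) cmat)"
proof -
  have "(0::nat) < CARD('n)" by simp
  from T_matrix_entries[OF this, of 0] obtain c where c: "c \<noteq> 0"
    and T: "\<And>i j. (T_matrix 0 0 :: 'n cmat) $ i $ j = of_real
    (if level i = level j
     then c * level_weight (top_level TYPE('n)) (level i) * level_weight (top_level TYPE('n)) (level j)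
            * racah_sum (top_level TYPE('n)) 0 0 (level i)
     else 0)"
    by auto
  have "level_weight n a * level_weight n a * racah_sum n 0 0 a = 1" if "0 \<le> a" "a \<le> n" for n a
    using that by (simp add: level_weight_def racah_sum_def racah_term_def rfact_def)
  then have "c * level_weight (top_level TYPE('n)) (level i) * level_weight (top_level TYPE('n)) (level i)
      * racah_sum (top_level TYPE('n)) 0 0 (level i) = c" for i :: 'n
    using level_range[of i] by (simp add: mult.assoc)
  note diag = this
  have "(T_matrix 0 0 :: 'n cmat) $ i $ j = cscale (of_real c) (mat 1) $ i $ j" for i j
    by (cases "i = j") (simp_all add: T diag mat_def level_inj del: of_real_mult)
  then have "T_matrix 0 0 = cscale (of_real c) (mat 1 :: 'n cmat)" by (simp add: vec_eq_iff)
  then show ?thesis using c by (intro exI[of _ "of_real c"]) auto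
qed

text \<open>
  \<open>T_matrix 0 0\<close> is a multiple of the identity, and the trace is the inner product with the
  identity.
\<close>

lemma trace_T_at:
  assumes p: "p \<in> spherical_indices CARD('n::{finite,linorder})"
  shows "trace (T_at p :: 'n cmat) = 0 \<longleftrightarrow> p \<noteq> (0, 0)"
proof -
  have zero: "(0, 0) \<in> spherical_indices CARD('n)" by (simp add: spherical_indices_def)
  obtain c where c: "c \<noteq> 0" and T0: "T_matrix 0 0 = cscale c (mat 1 :: 'n cmat)"
    using T_matrix_0_0 by blast
  show ?thesis
  proof (cases "p = (0, 0)")
    case True
    then show ?thesis using c by (simp add: T0 trace_cscale trace_I)
  next
    case False
    have "orthogonal (cscale (1 / c) (T_at (0, 0) :: 'n cmat)) (cscale 1 (T_at p))"
      by (rule T_at_orthogonal[OF zero p]) (use False in simp)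
    moreover have "cscale (1 / c) (T_at (0, 0)) = (mat 1 :: 'n cmat)"
      using c by (simp add: T0 vec_eq_iff)
    moreover have "cscale 1 (T_at p) = (T_at p :: 'n cmat)" by (simp add: vec_eq_iff)
    ultimately have "Re (trace (T_at p :: 'n cmat)) = 0" by (simp add: orthogonal_def inner_eq_trace)
    moreover have "Im (trace (T_at p :: 'n cmat)) = 0"
      unfolding trace_def by (subst T_matrix_real) simp
    ultimately show ?thesis using False by (simp add: complex_eq_iff)
  qed
qed

lemma trace_sum: "trace (\<Sum>p\<in>J. f p) = (\<Sum>p\<in>J. trace (f p :: ('n::finite) cmat))"
  unfolding trace_def by (simp add: sum.swap[of _ UNIV J])

lemma trace_spherical_sum:
  "trace (\<Sum>p\<in>spherical_indices CARD('n). cscale (c p) (T_at p :: ('n::{finite,linorder}) cmat)) = 0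
    \<longleftrightarrow> c (0, 0) = 0"
proof -
  have zero: "(0, 0) \<in> spherical_indices CARD('n)" by (simp add: spherical_indices_def)
  have "trace (\<Sum>p\<in>spherical_indices CARD('n). cscale (c p) (T_at p :: 'n cmat))
      = (\<Sum>p\<in>spherical_indices CARD('n). c p * trace (T_at p :: 'n cmat))"
    by (simp add: trace_sum trace_cscale)
  also have "\<dots> = (\<Sum>p\<in>{(0, 0)}. c p * trace (T_at p :: 'n cmat))"
    by (rule sum.mono_neutral_right) (use zero trace_T_at in \<open>auto simp: finite_spherical_indices\<close>)
  also have "\<dots> = c (0, 0) * trace (T_at (0, 0) :: 'n cmat)" by simp
  finally show ?thesis using trace_T_at[OF zero] by simp
qed

text \<open>The smallest eigenvalue on traceless matrices, in modulus, is \<open>1 \<cdot> (1 + 1) = 2\<close>.\<close>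

lemma casimir_gap:
  fixes X :: "('n::{finite,linorder}) cmat"
  assumes "trace X = 0"
  shows "2 * norm X \<le> norm (casimir X)"
proof -
  define I where "I = spherical_indices CARD('n)"
  obtain c where X: "X = (\<Sum>p\<in>I. cscale (c p) (T_at p))"
    unfolding I_def by (rule spherical_expansion)
  have c0: "c (0, 0) = 0" using assms trace_spherical_sum unfolding X I_def by blast
  have "casimir X = (\<Sum>p\<in>I. cscale (- of_nat (fst p * (fst p + 1)) * c p) (T_at p))"
    unfolding X casimir_sum casimir_cscale
  proof (rule sum.cong[OF refl])
    fix p assume "p \<in> I"
    then have "casimir (T_at p :: 'n cmat) = cscale (- of_nat (fst p * (fst p + 1))) (T_at p)"
      unfolding I_def by (rule casimir_T_at)
    then show "cscale (c p) (casimir (T_at p))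
        = cscale (- of_nat (fst p * (fst p + 1)) * c p) (T_at p :: 'n cmat)"
      by (simp add: vec_eq_iff)
  qed
  then have "(norm (casimir X))\<^sup>2
      = (\<Sum>p\<in>I. (cmod (- of_nat (fst p * (fst p + 1)) * c p))\<^sup>2 * (norm (T_at p :: 'n cmat))\<^sup>2)"
    using norm_spherical_sum[of I "\<lambda>p. - of_nat (fst p * (fst p + 1)) * c p", where 'n = 'n]
    by (simp add: I_def)
  moreover have "(2 * norm X)\<^sup>2 = (\<Sum>p\<in>I. 4 * ((cmod (c p))\<^sup>2 * (norm (T_at p :: 'n cmat))\<^sup>2))"
    using norm_spherical_sum[of I c, where 'n = 'n]
    by (simp add: I_def power_mult_distrib sum_distrib_left X)
  moreover have "4 * ((cmod (c p))\<^sup>2 * (norm (T_at p :: 'n cmat))\<^sup>2)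
      \<le> (cmod (- of_nat (fst p * (fst p + 1)) * c p))\<^sup>2 * (norm (T_at p :: 'n cmat))\<^sup>2"
    if "p \<in> I" for p
  proof (cases "c p = 0")
    case False
    have "fst p \<noteq> 0"
    proof
      assume "fst p = 0"
      then have "p = (0, 0)" using spherical_indicesD(2)[OF that[unfolded I_def]] by (cases p) auto
      then show False using c0 False by simp
    qed
    then have "1 \<le> fst p" by simp
    then have "1 * (1 + 1) \<le> fst p * (fst p + 1)" by (intro mult_mono) auto
    then have "real (1 * (1 + 1)) \<le> real (fst p * (fst p + 1))" by (simp only: of_nat_le_iff)
    moreover have "real (1 * (1 + 1)) = 2" by simp
    ultimately have "2 \<le> real (fst p * (fst p + 1))" by linarith
    then have "2\<^sup>2 \<le> (real (fst p * (fst p + 1)))\<^sup>2" by (rule power_mono) simp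
    then have "4 * (cmod (c p))\<^sup>2 \<le> (real (fst p * (fst p + 1)))\<^sup>2 * (cmod (c p))\<^sup>2"
      by (intro mult_right_mono) simp_all
    also have "\<dots> = (cmod (- of_nat (fst p * (fst p + 1)) * c p))\<^sup>2"
      by (simp only: norm_mult norm_minus_cancel norm_of_nat power_mult_distrib)
    finally have "4 * (cmod (c p))\<^sup>2 * (norm (T_at p :: 'n cmat))\<^sup>2
        \<le> (cmod (- of_nat (fst p * (fst p + 1)) * c p))\<^sup>2 * (norm (T_at p :: 'n cmat))\<^sup>2"
      by (rule mult_right_mono) simp
    then show ?thesis by (simp only: mult.assoc)
  qed simp
  ultimately have "(2 * norm X)\<^sup>2 \<le> (norm (casimir X))\<^sup>2" by (simp add: sum_mono)
  then show ?thesis by (rule power2_le_imp_le) simp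
qed

text \<open>
  The coefficients are divided by the eigenvalues; for \<open>l = 0\<close> this is a division by \<open>0\<close> with
  value \<open>0\<close>, as it should be, because the coefficient itself vanishes on traceless matrices.
\<close>

lemma casimir_surjective_traceless:
  fixes X :: "('n::{finite,linorder}) cmat"
  assumes "trace X = 0"
  obtains A where "trace A = 0" "casimir A = X"
proof -
  define I where "I = spherical_indices CARD('n)"
  obtain c where X: "X = (\<Sum>p\<in>I. cscale (c p) (T_at p))"
    unfolding I_def by (rule spherical_expansion)
  have c0: "c (0, 0) = 0" using assms trace_spherical_sum unfolding X I_def by blast
  define d where "d p = - c p / of_nat (fst p * (fst p + 1))" for p
  define A where "A = (\<Sum>p\<in>I. cscale (d p) (T_at p :: 'n cmat))"
  have "trace A = 0"
    using trace_spherical_sum[of d, where 'n = 'n] c0 by (simp add: A_def I_def d_def)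
  moreover have "casimir A = X"
    unfolding A_def X casimir_sum casimir_cscale
  proof (rule sum.cong[OF refl])
    fix p assume p: "p \<in> I"
    then have T: "casimir (T_at p :: 'n cmat) = cscale (- of_nat (fst p * (fst p + 1))) (T_at p)"
      unfolding I_def by (rule casimir_T_at)
    have "d p * - of_nat (fst p * (fst p + 1)) = c p"
    proof (cases "fst p = 0")
      case True
      then have "p = (0, 0)" using spherical_indicesD(2)[OF p[unfolded I_def]] by (cases p) auto
      then show ?thesis by (simp add: c0)
    next
      case False
      then have "(of_nat (fst p * (fst p + 1)) :: complex) \<noteq> 0" by (simp only: of_nat_eq_0_iff) simp
      then show ?thesis by (simp add: d_def del: of_nat_mult of_nat_add)
    qed
    then show "cscale (d p) (casimir (T_at p)) = cscale (c p) (T_at p :: 'n cmat)"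
      unfolding T by (simp add: vec_eq_iff mult.assoc[symmetric] del: mult_minus_right)
  qed
  ultimately show thesis by (rule that)
qed

definition traceless_part :: "('n::finite) cmat \<Rightarrow> 'n cmat" where
  "traceless_part X = X - cscale (trace X / of_nat CARD('n)) (mat 1)"

lemma trace_traceless_part: "trace (traceless_part X) = 0"
  by (simp add: traceless_part_def trace_sub trace_cscale trace_I)

lemma
  fixes X :: "('n::{finite,linorder}) cmat"
  shows trace_inverse_laplacian: "trace (inverse_laplacian X) = 0"
    and casimir_inverse_laplacian: "casimir (inverse_laplacian X) = traceless_part X"
proof -
  obtain A where A: "trace A = 0" "casimir A = traceless_part X"
    using casimir_surjective_traceless[OF trace_traceless_part] by blast
  then have "traceless_part X \<in> discrete_laplacian ` {A. trace A = 0}"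
    by (auto simp: discrete_laplacian_eq_casimir intro!: image_eqI[of _ _ A])
  from inv_into_into[OF this] f_inv_into_f[OF this]
  show "trace (inverse_laplacian X) = 0" "casimir (inverse_laplacian X) = traceless_part X"
    unfolding inverse_laplacian_def traceless_part_def[symmetric]
    by (simp_all add: discrete_laplacian_eq_casimir)
qed

lemma inverse_laplacian_unique:
  assumes "trace A = 0" "casimir A = traceless_part X"
  shows "inverse_laplacian X = A"
proof -
  have "2 * norm (inverse_laplacian X - A) \<le> norm (casimir (inverse_laplacian X - A))"
    by (rule casimir_gap) (simp add: trace_sub trace_inverse_laplacian assms)
  then show ?thesis by (simp add: casimir_diff casimir_inverse_laplacian assms)
qed

lemma inverse_laplacian_diff:
  "inverse_laplacian (X - Y) = inverse_laplacian X - inverse_laplacian Y"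
  by (rule inverse_laplacian_unique)
     (simp_all add: trace_sub trace_inverse_laplacian casimir_diff casimir_inverse_laplacian,
      simp add: traceless_part_def vec_eq_iff trace_sub algebra_simps diff_divide_distrib)

lemma inverse_laplacian_adj: "inverse_laplacian (adj X) = adj (inverse_laplacian X)"
proof (rule inverse_laplacian_unique)
  have tr: "trace (adj A) = cnj (trace A)" for A :: "'a cmat" by (simp add: trace_def)
  show "trace (adj (inverse_laplacian X)) = 0" by (simp add: tr trace_inverse_laplacian)
  show "casimir (adj (inverse_laplacian X)) = traceless_part (adj X)"
    unfolding casimir_adj casimir_inverse_laplacian
    by (simp add: traceless_part_def tr vec_eq_iff mat_def)
qed

text \<open>
  Removing the trace is an orthogonal projection, and the spectral gap is \<open>2\<close>.
\<close>

lemma norm_inverse_laplacian_le: "norm (inverse_laplacian X) \<le> norm X / 2"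
proof -
  have "orthogonal (traceless_part X) (cscale z (mat 1))" for z
  proof -
    have "adj (cscale z (mat 1)) ** traceless_part X = cscale (cnj z) (traceless_part X)"
      by (simp add: vec_eq_iff matrix_matrix_mult_def mat_def if_distrib[where f="\<lambda>x. _ * x"]
          if_distrib[where f="\<lambda>x. x * _"] if_distrib[where f=cnj] cong: if_cong)
    then show ?thesis
      unfolding orthogonal_def inner_commute[of "traceless_part X"]
      by (simp add: inner_eq_trace trace_cscale trace_traceless_part)
  qed
  from norm_add_Pythagorean[OF this, of "trace X / of_nat CARD('a)"]
  have "(norm (traceless_part X))\<^sup>2 \<le> (norm X)\<^sup>2" by (simp add: traceless_part_def)
  then have "norm (traceless_part X) \<le> norm X" by (rule power2_le_imp_le) simp
  then show ?thesis
    using casimir_gap[OF trace_inverse_laplacian[of X]] by (simp add: casimir_inverse_laplacian)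
qed


section \<open>A Gronwall estimate\<close>

text \<open>
  The norm need not be differentiable where it vanishes, so \<open>sqrt (\<parallel>f\<parallel>\<^sup>2 + \<epsilon>\<^sup>2)\<close> is estimated
  instead, and \<open>\<epsilon>\<close> tends to \<open>0\<close>.
\<close>

lemma gronwall_norm:
  fixes f :: "real \<Rightarrow> 'a::real_inner"
  assumes K: "K > 0" and C: "C \<ge> 0" and f0: "f 0 = 0"
    and deriv: "\<And>t. t \<in> {0..T} \<Longrightarrow> (f has_vector_derivative f' t) (at t within {0..T})"
    and bound: "\<And>t. t \<in> {0..T} \<Longrightarrow> norm (f' t) \<le> K * norm (f t) + C"
    and t: "t \<in> {0..T}"
  shows "norm (f t) \<le> C / K * (exp (K * t) - 1)"
proof (rule field_le_epsilon)
  fix e :: real assume e: "e > 0"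
  define \<epsilon> where "\<epsilon> = e / exp (K * t)"
  have \<epsilon>: "\<epsilon> > 0" using e by (simp add: \<epsilon>_def)
  define \<phi> where "\<phi> s = sqrt (inner (f s) (f s) + \<epsilon>\<^sup>2)" for s
  have pos: "inner (f s) (f s) + \<epsilon>\<^sup>2 > 0" for s using \<epsilon> by (simp add: add_nonneg_pos)
  have \<phi>_pos: "\<phi> s > 0" for s using pos[of s] by (simp add: \<phi>_def)
  have le_\<phi>: "norm (f s) \<le> \<phi> s" for s by (simp add: \<phi>_def norm_eq_sqrt_inner)
  define g where "g s = (\<phi> s + C / K) * exp (- K * s)" for s
  have g_deriv: "(g has_real_derivative
      (inner (f s) (f' s) / \<phi> s - K * (\<phi> s + C / K)) * exp (- K * s)) (at s within {0..T})"
    if s: "s \<in> {0..T}" for s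
  proof -
    have "((\<lambda>s. inner (f s) (f s)) has_real_derivative 2 * inner (f s) (f' s)) (at s within {0..T})"
      using bounded_bilinear.has_vector_derivative[OF bounded_bilinear_inner deriv[OF s] deriv[OF s]]
      by (simp add: has_real_derivative_iff_has_vector_derivative inner_commute)
    then have "((\<lambda>s. inner (f s) (f s) + \<epsilon>\<^sup>2) has_real_derivative 2 * inner (f s) (f' s))
        (at s within {0..T})"
      by (auto intro!: derivative_eq_intros)
    from DERIV_chain2[OF DERIV_real_sqrt[OF pos[of s]] this]
    have "(\<phi> has_real_derivative inner (f s) (f' s) / \<phi> s) (at s within {0..T})"
      by (simp add: \<phi>_def[abs_def] field_simps)
    then show ?thesis
      unfolding g_def by (auto intro!: derivative_eq_intros simp: algebra_simps)
  qed
  have g_nonpos: "(inner (f s) (f' s) / \<phi> s - K * (\<phi> s + C / K)) * exp (- K * s) \<le> 0"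
    if s: "s \<in> {0..T}" for s
  proof -
    have "inner (f s) (f' s) \<le> norm (f s) * norm (f' s)" by (rule norm_cauchy_schwarz)
    also have "\<dots> \<le> \<phi> s * (K * \<phi> s + C)"
    proof (rule mult_mono)
      show "norm (f' s) \<le> K * \<phi> s + C"
        using bound[OF s] mult_left_mono[OF le_\<phi>[of s], of K] K by linarith
    qed (use le_\<phi>[of s] \<phi>_pos[of s] in auto)
    finally have "inner (f s) (f' s) / \<phi> s \<le> K * \<phi> s + C"
      using \<phi>_pos[of s] by (simp add: divide_le_eq mult.commute)
    moreover have "K * (\<phi> s + C / K) = K * \<phi> s + C" using K by (simp add: distrib_left)
    ultimately show ?thesis by (simp add: mult_nonpos_nonneg)
  qed
  have "g t \<le> g 0"
  proof (rule DERIV_nonpos_imp_decreasing_open[of 0 t g])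
    show "0 \<le> t" using t by simp
    show "\<exists>y. (g has_real_derivative y) (at s) \<and> y \<le> 0" if "0 < s" "s < t" for s
    proof -
      have "s \<in> {0..T}" "at s within {0..T} = at s" using that t by (auto simp: at_within_Icc_at)
      then show ?thesis using g_deriv[of s] g_nonpos[of s] by auto
    qed
    have "continuous_on {0..T} g"
      using g_deriv by (meson DERIV_continuous continuous_on_eq_continuous_within)
    then show "continuous_on {0..t} g" by (rule continuous_on_subset) (use t in auto)
  qed
  then have "(\<phi> t + C / K) * exp (- K * t) \<le> \<epsilon> + C / K"
    using \<epsilon> by (simp add: g_def \<phi>_def f0)
  then have "\<phi> t + C / K \<le> (\<epsilon> + C / K) * exp (K * t)"
    by (simp add: exp_minus field_simps)
  then have "\<phi> t \<le> C / K * (exp (K * t) - 1) + e"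
    by (simp add: \<epsilon>_def algebra_simps)
  then show "norm (f t) \<le> C / K * (exp (K * t) - 1) + e" using le_\<phi>[of t] by linarith
qed

section \<open>Linear matrix differential equations\<close>

text \<open>
  The terms of the series obtained by Picard iteration for \<open>R' = A R\<close>, \<open>R 0 = I\<close>.
\<close>

fun picard :: "(real \<Rightarrow> ('n::finite) cmat) \<Rightarrow> nat \<Rightarrow> real \<Rightarrow> 'n cmat" where
  "picard A 0 t = mat 1"
| "picard A (Suc k) t = integral {0..t} (\<lambda>s. A s ** picard A k s)"

lemma picard_Suc_eq: "picard A (Suc k) = (\<lambda>t. integral {0..t} (\<lambda>s. A s ** picard A k s))"
  by (simp add: fun_eq_iff)

lemma picard_continuous:
  assumes A: "continuous_on {0..T} A"
  shows "continuous_on {0..T} (picard A k)"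
proof (induction k)
  case (Suc k)
  have "continuous_on {0..T} (\<lambda>s. A s ** picard A k s)" by (intro continuous_intros A Suc)
  then have "continuous_on {0..T} (\<lambda>t. integral {0..t} (\<lambda>s. A s ** picard A k s))"
    by (intro indefinite_integral_continuous_1 integrable_continuous_real)
  then show ?case by (simp only: picard_Suc_eq)
qed (simp add: fun_eq_iff)

lemma picard_derivative:
  assumes A: "continuous_on {0..T} A" and t: "t \<in> {0..T}"
  shows "(picard A (Suc k) has_vector_derivative A t ** picard A k t) (at t within {0..T})"
proof -
  have "continuous_on {0..T} (\<lambda>s. A s ** picard A k s)"
    by (intro continuous_intros A picard_continuous)
  from integral_has_vector_derivative[OF this t] show ?thesis
    by (simp only: picard_Suc_eq)
qed

lemma picard_bound:
  fixes A :: "real \<Rightarrow> ('n::finite) cmat"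
  assumes A: "continuous_on {0..T} A" and C: "\<And>s. s \<in> {0..T} \<Longrightarrow> norm (A s) \<le> C" and t: "t \<in> {0..T}"
  shows "norm (picard A k t) \<le> norm (mat 1 :: 'n cmat) * (C * t) ^ k / fact k"
  using t
proof (induction k arbitrary: t)
  case (Suc k)
  have C0: "0 \<le> C" using C[OF Suc.prems] norm_ge_zero order_trans by blast
  define c where "c = norm (mat 1 :: 'n cmat)"
  have sub: "{0..t} \<subseteq> {0..T}" using Suc.prems by auto
  have "((\<lambda>s. c * (C * s) ^ Suc k / fact (Suc k)) has_real_derivative
      C * (c * (C * s) ^ k / fact k)) (at s within {0..t})" for s
  proof -
    define a where "a = c * C ^ Suc k / fact (Suc k)"
    have "((\<lambda>s. a * s ^ Suc k) has_real_derivative a * (real (Suc k) * s ^ k)) (at s within {0..t})"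
      using DERIV_cmult[OF DERIV_pow[of "Suc k" s]] by simp
    moreover have "a * (real (Suc k) * s ^ k) = C * (c * (C * s) ^ k / fact k)"
    proof -
      have "a * real (Suc k) = c * C ^ Suc k / fact k"
        unfolding a_def fact_Suc of_nat_mult by (simp del: power_Suc of_nat_Suc)
      then have "a * (real (Suc k) * s ^ k) = c * C ^ Suc k / fact k * s ^ k" by (simp only: mult.assoc[symmetric])
      then show ?thesis by (simp add: power_mult_distrib)
    qed
    moreover have "(\<lambda>s. a * s ^ Suc k) = (\<lambda>s. c * (C * s) ^ Suc k / fact (Suc k))"
      by (simp add: a_def power_mult_distrib fun_eq_iff del: power_Suc fact_Suc)
    ultimately show ?thesis by (simp only:)
  qed
  then have int: "((\<lambda>s. C * (c * (C * s) ^ k / fact k)) has_integral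
      c * (C * t) ^ Suc k / fact (Suc k) - c * (C * 0) ^ Suc k / fact (Suc k)) {0..t}"
    using Suc.prems
    by (intro fundamental_theorem_of_calculus)
       (auto simp flip: has_real_derivative_iff_has_vector_derivative)
  have "norm (picard A (Suc k) t) \<le> integral {0..t} (\<lambda>s. C * (c * (C * s) ^ k / fact k))"
    unfolding picard.simps
  proof (rule integral_norm_bound_integral)
    show "(\<lambda>s. A s ** picard A k s) integrable_on {0..t}"
      by (intro integrable_continuous_real continuous_intros
            continuous_on_subset[OF A sub] continuous_on_subset[OF picard_continuous[OF A] sub])
    show "(\<lambda>s. C * (c * (C * s) ^ k / fact k)) integrable_on {0..t}" using int by blast
    show "norm (A s ** picard A k s) \<le> C * (c * (C * s) ^ k / fact k)" if "s \<in> {0..t}" for s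
    proof -
      have s: "s \<in> {0..T}" using that sub by blast
      have "norm (A s ** picard A k s) \<le> norm (A s) * norm (picard A k s)" by (rule norm_matrix_mult_le)
      also have "\<dots> \<le> C * (c * (C * s) ^ k / fact k)"
        unfolding c_def using C[OF s] Suc.IH[OF s] C0 by (intro mult_mono) auto
      finally show ?thesis .
    qed
  qed
  also have "\<dots> = c * (C * t) ^ Suc k / fact (Suc k)" using integral_unique[OF int] by simp
  finally show ?case unfolding c_def .
qed simp

text \<open>The Picard series converges uniformly together with its termwise derivative.\<close>

theorem linear_ode_solution:
  fixes A :: "real \<Rightarrow> ('n::finite) cmat"
  assumes T: "0 \<le> T" and A: "continuous_on {0..T} A"
  obtains R where "R 0 = mat 1"
    "\<And>t. t \<in> {0..T} \<Longrightarrow> (R has_vector_derivative A t ** R t) (at t within {0..T})"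
proof -
  obtain C where C: "\<And>s. s \<in> {0..T} \<Longrightarrow> norm (A s) \<le> C"
    using compact_imp_bounded[OF compact_continuous_image[OF A compact_Icc]]
    unfolding bounded_iff by blast
  have C0: "0 \<le> C" using order_trans[OF norm_ge_zero C[of 0]] T by simp
  define c where "c = norm (mat 1 :: 'n cmat)"
  define M where "M k = c * (C * T) ^ k / fact k" for k
  have bound: "norm (picard A k t) \<le> M k" if "t \<in> {0..T}" for k t
  proof -
    have "norm (picard A k t) \<le> c * (C * t) ^ k / fact k"
      unfolding c_def by (rule picard_bound[OF A C that])
    also have "\<dots> \<le> M k" unfolding M_def
      using that C0 by (intro divide_right_mono mult_left_mono power_mono) (auto simp: c_def)
    finally show ?thesis .
  qed
  have "summable (\<lambda>k. c * ((C * T) ^ k /\<^sub>R fact k))"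
    by (intro summable_mult summable_exp_generic)
  then have "summable M" by (simp add: M_def[abs_def] field_simps)
  define R where "R t = (\<Sum>k. picard A k t)" for t
  have unif: "uniform_limit {0..T} (\<lambda>k t. \<Sum>i<k. picard A i t) R sequentially"
    unfolding R_def by (rule Weierstrass_m_test[OF bound \<open>summable M\<close>])
  define D where "D k t = (case k of 0 \<Rightarrow> 0 | Suc k \<Rightarrow> A t ** picard A k t)" for k t
  have "\<exists>g. \<forall>t\<in>{0..T}. (\<lambda>k. picard A k t) sums g t \<and>
      (g has_derivative (\<lambda>h. h *\<^sub>R (A t ** R t))) (at t within {0..T})"
  proof (rule has_derivative_series[where f' = "\<lambda>k t h. h *\<^sub>R D k t" and x = 0 and l = "R 0"])
    show "convex {0..T}" by simp
    show "(picard A k has_derivative (\<lambda>h. h *\<^sub>R D k t)) (at t within {0..T})" if "t \<in> {0..T}" for k t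
    proof (cases k)
      case 0
      moreover have "picard A 0 = (\<lambda>_. mat 1)" by (simp add: fun_eq_iff)
      ultimately show ?thesis by (simp add: D_def)
    next
      case (Suc j)
      then show ?thesis using picard_derivative[OF A that, of j]
        by (simp add: D_def has_vector_derivative_def)
    qed
    show "(\<lambda>k. picard A k 0) sums R 0"
    proof -
      have "norm (picard A k 0) \<le> M k" for k by (rule bound) (use T in simp)
      then have "summable (\<lambda>k. picard A k 0)"
        by (intro summable_comparison_test'[OF \<open>summable M\<close>])
      then show ?thesis unfolding R_def by (rule summable_sums)
    qed
    show "0 \<in> {0..T}" using T by simp
    fix e :: real assume e: "0 < e"
    define e' where "e' = e / (C + 1)"
    have "e' > 0" using e C0 by (simp add: e'_def)
    then have "\<forall>\<^sub>F k in sequentially. \<forall>t\<in>{0..T}. dist (\<Sum>i<k. picard A i t) (R t) < e'"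
      using unif unfolding uniform_limit_iff by blast
    then have "\<forall>\<^sub>F k in sequentially. \<forall>t\<in>{0..T}. dist (\<Sum>i<k - 1. picard A i t) (R t) < e'"
      by (rule eventually_compose_filterlim) (rule filterlim_minus_const_nat_at_top)
    then show "\<forall>\<^sub>F k in sequentially. \<forall>t\<in>{0..T}. \<forall>h.
        norm ((\<Sum>i<k. h *\<^sub>R D i t) - h *\<^sub>R (A t ** R t)) \<le> e * norm h"
    proof (rule eventually_mono, intro ballI allI)
      fix k t h
      assume near: "\<forall>t\<in>{0..T}. dist (\<Sum>i<k - 1. picard A i t) (R t) < e'" and t: "t \<in> {0..T}"
      have "(\<Sum>i<k. D i t) = A t ** (\<Sum>i<k - 1. picard A i t)"
      proof (cases k)
        case (Suc j)
        have "(\<Sum>i<Suc j. D i t) = (\<Sum>i<j. A t ** picard A i t)"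
          unfolding sum.lessThan_Suc_shift by (simp add: D_def)
        then show ?thesis
          using Suc by (simp add: bounded_bilinear.sum_right[OF bounded_bilinear_matrix_mult])
      qed simp
      then have "(\<Sum>i<k. h *\<^sub>R D i t) - h *\<^sub>R (A t ** R t)
          = h *\<^sub>R (A t ** ((\<Sum>i<k - 1. picard A i t) - R t))"
        by (simp add: scaleR_sum_right[symmetric] matrix_diff_ldistrib scaleR_diff_right)
      then have "norm ((\<Sum>i<k. h *\<^sub>R D i t) - h *\<^sub>R (A t ** R t))
          \<le> \<bar>h\<bar> * (norm (A t) * norm ((\<Sum>i<k - 1. picard A i t) - R t))"
        by (simp add: mult_left_mono norm_matrix_mult_le)
      also have "\<dots> \<le> \<bar>h\<bar> * (C * e')"
        using C[OF t] C0 near t by (intro mult_left_mono mult_mono) (auto simp: dist_norm less_imp_le)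
      also have "\<dots> \<le> \<bar>h\<bar> * e"
        using C0 e by (intro mult_left_mono) (auto simp: e'_def field_simps)
      finally show "norm ((\<Sum>i<k. h *\<^sub>R D i t) - h *\<^sub>R (A t ** R t)) \<le> e * norm h"
        by (simp add: mult.commute)
    qed
  qed
  then obtain g where g: "\<And>t. t \<in> {0..T} \<Longrightarrow> (\<lambda>k. picard A k t) sums g t"
    and g': "\<And>t. t \<in> {0..T} \<Longrightarrow> (g has_vector_derivative A t ** R t) (at t within {0..T})"
    unfolding has_vector_derivative_def by blast
  have gR: "R t = g t" if "t \<in> {0..T}" for t using sums_unique[OF g[OF that]] by (simp add: R_def)
  have "g 0 = mat 1"
  proof -
    have "picard A k 0 = (if k = 0 then mat 1 else 0)" for k by (cases k) auto
    then have "(\<lambda>k. picard A k 0) sums mat 1" using sums_single[of 0 "\<lambda>_. mat 1 :: 'n cmat"] by simp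
    then show ?thesis using g[of 0] T sums_unique2 by auto
  qed
  with g' gR show thesis by (intro that[of g]) auto
qed

text \<open>
  If \<open>R' = A R\<close> with skew-Hermitian \<open>A\<close>, then \<open>R\<^sup>* R\<close> has derivative \<open>R\<^sup>* (A\<^sup>* + A) R = 0\<close>.
\<close>

lemma skew_flow_unitary:
  fixes R A :: "real \<Rightarrow> ('n::finite) cmat"
  assumes R0: "R 0 = mat 1" and skew: "\<And>t. t \<in> {0..T} \<Longrightarrow> adj (A t) = - A t"
    and R: "\<And>t. t \<in> {0..T} \<Longrightarrow> (R has_vector_derivative A t ** R t) (at t within {0..T})"
    and t: "t \<in> {0..T}"
  shows "R t \<in> unitary_group"
proof -
  have "((\<lambda>s. adj (R s) ** R s) has_vector_derivative 0) (at s within {0..T})" if s: "s \<in> {0..T}" for s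
    using matrix_mult_has_vector_derivative[OF adj_has_vector_derivative[OF R[OF s]] R[OF s]]
    by (simp add: adj_mult skew[OF s] matrix_ring_simps matrix_mul_assoc)
  then obtain c where c: "\<And>s. s \<in> {0..T} \<Longrightarrow> adj (R s) ** R s = c"
    using has_vector_derivative_zero_constant[of "{0..T}" "\<lambda>s. adj (R s) ** R s"] by auto
  have "adj (R t) ** R t = mat 1" using c[OF t] c[of 0] t R0 by simp
  then show ?thesis using matrix_left_right_inverse by (auto simp: unitary_group_def)
qed

text \<open>
  Lax's argument: in the frame that moves with \<open>R\<close> the solution \<open>W\<close> of \<open>W' = [A, W]\<close> stands
  still, that is, \<open>R\<^sup>* W R\<close> is constant.
\<close>

lemma skew_flow_conjugates:
  fixes R A W :: "real \<Rightarrow> ('n::finite) cmat"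
  assumes R0: "R 0 = mat 1" and skew: "\<And>t. t \<in> {0..T} \<Longrightarrow> adj (A t) = - A t"
    and R: "\<And>t. t \<in> {0..T} \<Longrightarrow> (R has_vector_derivative A t ** R t) (at t within {0..T})"
    and W: "\<And>t. t \<in> {0..T} \<Longrightarrow> (W has_vector_derivative A t ** W t - W t ** A t) (at t within {0..T})"
    and t: "t \<in> {0..T}"
  shows "W t = R t ** W 0 ** adj (R t)"
proof -
  have "((\<lambda>s. adj (R s) ** W s ** R s) has_vector_derivative 0) (at s within {0..T})"
    if s: "s \<in> {0..T}" for s
    using matrix_mult_has_vector_derivative[OF
        matrix_mult_has_vector_derivative[OF adj_has_vector_derivative[OF R[OF s]] W[OF s]] R[OF s]]
    by (simp add: adj_mult skew[OF s] matrix_ring_simps matrix_mul_assoc)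
  then obtain c where c: "\<And>s. s \<in> {0..T} \<Longrightarrow> adj (R s) ** W s ** R s = c"
    using has_vector_derivative_zero_constant[of "{0..T}" "\<lambda>s. adj (R s) ** W s ** R s"] by auto
  have "adj (R t) ** W t ** R t = W 0" using c[OF t] c[of 0] t R0 by simp
  then have "R t ** W 0 ** adj (R t) = R t ** (adj (R t) ** W t ** R t) ** adj (R t)" by simp
  also have "\<dots> = W t"
    using skew_flow_unitary[OF R0 skew R t]
    by (simp add: matrix_mul_assoc unitaryD) (simp add: unitary_cancel)
  finally show ?thesis by simp
qed

lemma conjugation_derivative:
  fixes R :: "real \<Rightarrow> ('n::finite) cmat" and A Z0 :: "'n cmat"
  assumes R: "(R has_vector_derivative A ** R t) (at t within S)" and skew: "adj A = - A"
  defines "Z \<equiv> \<lambda>t. R t ** Z0 ** adj (R t)"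
  shows "(Z has_vector_derivative A ** Z t - Z t ** A) (at t within S)"
proof -
  have "((\<lambda>t. R t ** Z0) has_vector_derivative A ** R t ** Z0) (at t within S)"
    using matrix_mult_has_vector_derivative[OF R has_vector_derivative_const[of Z0]] by simp
  from matrix_mult_has_vector_derivative[OF this adj_has_vector_derivative[OF R]] show ?thesis
    unfolding Z_def by (simp add: adj_mult skew matrix_ring_simps matrix_mul_assoc)
qed


section \<open>The Euler--Zeitlin flow\<close>

lemma hbar_nonneg: "0 \<le> hbar CARD('n::finite)"
proof -
  have "1 \<le> (real CARD('n))\<^sup>2" by simp
  then show ?thesis by (simp add: hbar_def)
qed

lemma adj_bracket: "adj (bracket A B) = - bracket (adj A) (adj B)"
  by (simp add: bracket_def adj_mult algebra_simps)

lemma bracket_diff_left: "bracket (A - B) C = bracket A C - bracket B C"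
  and bracket_diff_right: "bracket C (A - B) = bracket C A - bracket C B"
  by (simp_all add: bracket_def matrix_ring_simps algebra_simps)

lemma bracket_swap: "bracket A B = - bracket B A"
  by (simp add: bracket_def algebra_simps)

lemma norm_bracket_le:
  "norm (bracket (A :: ('n::finite) cmat) B) \<le> 2 * norm A * norm B / hbar CARD('n)"
proof -
  have "norm (A ** B - B ** A) \<le> norm (A ** B) + norm (B ** A)" by (rule norm_triangle_ineq4)
  also have "\<dots> \<le> 2 * norm A * norm B"
    using norm_matrix_mult_le[of A B] norm_matrix_mult_le[of B A] by (simp add: mult.commute[of "norm B"])
  finally have "norm (A ** B - B ** A) / hbar CARD('n) \<le> 2 * norm A * norm B / hbar CARD('n)"
    using hbar_nonneg by (rule divide_right_mono)
  then show ?thesis using hbar_nonneg[where 'n = 'n] by (simp add: bracket_def divide_inverse mult.commute)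
qed

text \<open>
  The triangle inequality for the commutator costs a factor \<open>2\<close>, which the bound \<open>\<parallel>P B\<parallel> \<le> \<parallel>B\<parallel> / 2\<close>
  gains back.  This is why the final estimate has no numerical constant.
\<close>

lemma norm_bracket_inverse_laplacian_le:
  "norm (bracket (A :: ('n::{finite,linorder}) cmat) (inverse_laplacian B)) \<le> norm A * norm B / hbar CARD('n)"
proof -
  have "norm (bracket A (inverse_laplacian B)) \<le> 2 * norm A * norm (inverse_laplacian B) / hbar CARD('n)"
    by (rule norm_bracket_le)
  also have "\<dots> \<le> norm A * norm B / hbar CARD('n)"
    using mult_left_mono[OF norm_inverse_laplacian_le[of B], of "norm A"] hbar_nonneg
    by (intro divide_right_mono) auto
  finally show ?thesis .
qed

lemma continuous_on_inverse_laplacian: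
  assumes "continuous_on S W"
  shows "continuous_on S (\<lambda>t. inverse_laplacian (W t :: ('n::{finite,linorder}) cmat))"
proof -
  have "1-lipschitz_on UNIV (inverse_laplacian :: 'n cmat \<Rightarrow> 'n cmat)"
  proof (rule lipschitz_onI)
    fix X Y :: "'n cmat"
    show "dist (inverse_laplacian X) (inverse_laplacian Y) \<le> 1 * dist X Y"
      unfolding dist_norm inverse_laplacian_diff[symmetric]
      using norm_inverse_laplacian_le[of "X - Y"] norm_ge_zero[of "X - Y"] by linarith
  qed simp
  then have "continuous_on UNIV (inverse_laplacian :: 'n cmat \<Rightarrow> 'n cmat)"
    by (rule lipschitz_on_continuous_on)
  from continuous_on_compose2[OF this assms] show ?thesis by simp
qed

lemma euler_zeitlin_derivative:
  assumes "euler_zeitlin_solution T W0 W" "t \<in> {0..T}"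
  shows "(W has_vector_derivative bracket (W t) (inverse_laplacian (W t))) (at t within {0..T})"
proof -
  obtain D where D: "(W has_vector_derivative D) (at t within {0..T})"
    and eq: "D + bracket (inverse_laplacian (W t)) (W t) = 0"
    using assms unfolding euler_zeitlin_solution_def by blast
  have "D = bracket (W t) (inverse_laplacian (W t))"
    using eq by (subst bracket_swap) (simp add: eq_neg_iff_add_eq_0)
  then show ?thesis using D by simp
qed

lemma euler_zeitlin_continuous:
  assumes "euler_zeitlin_solution T W0 W"
  shows "continuous_on {0..T} W"
  using euler_zeitlin_derivative[OF assms] has_vector_derivative_continuous
  unfolding continuous_on_eq_continuous_within by blast

lemma inverse_laplacian_minus: "inverse_laplacian (- X) = - inverse_laplacian X"
proof -
  have "inverse_laplacian 0 = (0 :: 'a cmat)" using inverse_laplacian_diff[of 0 0] by simp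
  then show ?thesis using inverse_laplacian_diff[of 0 X] by simp
qed

text \<open>
  Since \<open>P\<close> commutes with the adjoint, \<open>- W\<^sup>*\<close> solves the same equation as \<open>W\<close>.  The initial
  values agree, and the field is Lipschitz on the bounded set that both curves stay in, so Gronwall
  shows that their difference vanishes.
\<close>

lemma euler_zeitlin_skew:
  fixes W :: "real \<Rightarrow> ('n::{finite,linorder}) cmat"
  assumes sol: "euler_zeitlin_solution T W0 W" and skew: "adj W0 = - W0" and t: "t \<in> {0..T}"
  shows "adj (W t) = - W t"
proof -
  define h where "h = hbar CARD('n)"
  have h: "0 \<le> h" by (simp add: h_def hbar_nonneg)
  obtain M where M: "\<And>s. s \<in> {0..T} \<Longrightarrow> norm (W s) \<le> M"
    using compact_imp_bounded[OF compact_continuous_image[OF euler_zeitlin_continuous[OF sol] compact_Icc]]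
    unfolding bounded_iff by blast
  have M0: "0 \<le> M" using order_trans[OF norm_ge_zero M[OF t]] .
  define P where "P = (inverse_laplacian :: 'n cmat \<Rightarrow> 'n cmat)"
  define V where "V s = W s + adj (W s)" for s
  define V' where "V' s = bracket (W s) (P (W s)) + adj (bracket (W s) (P (W s)))" for s
  have "norm (V t) \<le> 0 / (2 * M / h + 1) * (exp ((2 * M / h + 1) * t) - 1)"
  proof (rule gronwall_norm[where f' = V'])
    \<comment> \<open>the summand \<open>1\<close> only makes the Lipschitz constant positive\<close>
    show "0 < 2 * M / h + 1" using M0 h by (simp add: add_nonneg_pos)
    show "V 0 = 0" using sol skew by (simp add: V_def euler_zeitlin_solution_def)
    fix s assume s: "s \<in> {0..T}"
    show "(V has_vector_derivative V' s) (at s within {0..T})"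
      unfolding V_def V'_def P_def
      by (intro has_vector_derivative_add adj_has_vector_derivative euler_zeitlin_derivative[OF sol s])
    have adjW: "adj (W s) = V s - W s" by (simp add: V_def)
    have PV: "P (V s - W s) = P (V s) - P (W s)" by (simp add: P_def inverse_laplacian_diff)
    have "V' s = bracket (W s) (P (W s)) - bracket (adj (W s)) (P (adj (W s)))"
      by (simp add: V'_def adj_bracket P_def inverse_laplacian_adj)
    also have "\<dots> = bracket (W s) (P (V s)) - bracket (V s) (P (adj (W s)))"
      unfolding adjW by (simp add: bracket_diff_left bracket_diff_right PV)
    finally have "norm (V' s) \<le> norm (bracket (W s) (P (V s))) + norm (bracket (V s) (P (adj (W s))))"
      by (simp add: norm_triangle_ineq4)
    also have "\<dots> \<le> norm (W s) * norm (V s) / h + norm (V s) * norm (adj (W s)) / h"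
      unfolding P_def h_def by (intro add_mono norm_bracket_inverse_laplacian_le)
    also have "\<dots> = 2 * norm (W s) / h * norm (V s)" by (simp add: field_simps)
    also have "\<dots> \<le> (2 * M / h + 1) * norm (V s) + 0"
    proof -
      have "2 * norm (W s) / h \<le> 2 * M / h" using M[OF s] h by (intro divide_right_mono) auto
      then have "2 * norm (W s) / h \<le> 2 * M / h + 1" by linarith
      from mult_right_mono[OF this, of "norm (V s)"] show ?thesis by simp
    qed
    finally show "norm (V' s) \<le> (2 * M / h + 1) * norm (V s) + 0" .
  qed (use t in simp_all)
  then have "V t = 0" by simp
  then show ?thesis by (simp add: V_def add_eq_0_iff)
qed

text \<open>
  The flow moves its initial value by unitary conjugation: \<open>R\<close> solves the linear equation
  \<open>R' = - \<hbar>\<^sup>-\<^sup>1 P(W) R\<close> with skew-Hermitian generator.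
\<close>

lemma euler_zeitlin_unitary_conjugation:
  fixes W :: "real \<Rightarrow> ('n::{finite,linorder}) cmat"
  assumes T: "0 \<le> T" and sol: "euler_zeitlin_solution T W0 W" and skew: "adj W0 = - W0"
  obtains R where
    "\<And>t. t \<in> {0..T} \<Longrightarrow> R t \<in> unitary_group"
    "\<And>t. t \<in> {0..T} \<Longrightarrow> W t = R t ** W0 ** adj (R t)"
    "R 0 = mat 1"
    "\<And>t Z0. t \<in> {0..T} \<Longrightarrow>
      ((\<lambda>t. R t ** Z0 ** adj (R t)) has_vector_derivative
        bracket (R t ** Z0 ** adj (R t)) (inverse_laplacian (W t))) (at t within {0..T})"
proof -
  define A where "A t = - inverse (hbar CARD('n)) *\<^sub>R inverse_laplacian (W t)" for t
  have commutator: "A t ** X - X ** A t = bracket X (inverse_laplacian (W t))" for t X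
    by (simp add: A_def bracket_def matrix_ring_simps scaleR_diff_right)
  have "continuous_on {0..T} A"
    unfolding A_def by (intro continuous_intros continuous_on_inverse_laplacian
        euler_zeitlin_continuous[OF sol])
  then obtain R where R0: "R 0 = mat 1"
    and R: "\<And>t. t \<in> {0..T} \<Longrightarrow> (R has_vector_derivative A t ** R t) (at t within {0..T})"
    using linear_ode_solution[OF T] by blast
  have skew_A: "adj (A t) = - A t" if "t \<in> {0..T}" for t
  proof -
    have "adj (inverse_laplacian (W t)) = - inverse_laplacian (W t)"
      by (simp add: inverse_laplacian_adj[symmetric] inverse_laplacian_minus
          euler_zeitlin_skew[OF sol skew that])
    then show ?thesis by (simp add: A_def)
  qed
  show thesis
  proof (rule that)
    show "R t \<in> unitary_group" if "t \<in> {0..T}" for t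
      using skew_flow_unitary[OF R0 skew_A R that] .
    show "W t = R t ** W0 ** adj (R t)" if "t \<in> {0..T}" for t
    proof -
      have "W t = R t ** W 0 ** adj (R t)"
        by (rule skew_flow_conjugates[OF R0 skew_A R _ that])
           (simp_all add: commutator euler_zeitlin_derivative[OF sol])
      then show ?thesis using sol by (simp add: euler_zeitlin_solution_def)
    qed
    show "R 0 = mat 1" by fact
    show "((\<lambda>t. R t ** Z0 ** adj (R t)) has_vector_derivative
        bracket (R t ** Z0 ** adj (R t)) (inverse_laplacian (W t))) (at t within {0..T})"
      if "t \<in> {0..T}" for t Z0
      using conjugation_derivative[of R "A t" t, OF R[OF that] skew_A[OF that]]
      by (simp only: commutator)
  qed
qed

theorem proposition3p1:
  fixes W0 :: "('n::{finite,linorder}) cmat"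
    and W Y :: "real \<Rightarrow> 'n cmat"
    and r :: nat
    and T K :: real
  assumes "CARD('n) \<ge> 2"
    and "W0 \<in> special_skew_hermitian"
    and "1 \<le> r" and "r \<le> CARD('n)"
    and "r < CARD('n) \<Longrightarrow> singular_value W0 r > singular_value W0 (r + 1)"
    and "euler_zeitlin_solution T W0 W"
    and "euler_zeitlin_solution T (best_rank_approx r W0) Y"
    and "K > 0"
    and "K-lipschitz_on (coadjoint_orbit (best_rank_approx r W0)) hamiltonian_field"
  shows "\<forall>t\<in>{0<..T}.
    norm (Y t - best_rank_approx r (W t))
      \<le> norm (best_rank_approx r W0) / (hbar CARD('n) * K) * (exp (K * t) - 1)
         * sqrt (\<Sum>i = r + 1..CARD('n). (singular_value W0 i)\<^sup>2)"
proof
  fix t assume t: "t \<in> {0<..T}"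
  then have T: "0 \<le> T" and t': "t \<in> {0..T}" by auto
  define h where "h = hbar CARD('n)"
  have skew: "adj W0 = - W0"
    using assms(2) by (simp add: special_skew_hermitian_def skew_hermitian_def)
  obtain U \<sigma> V where svd: "is_svd W0 U \<sigma> V" by (rule svd_exists)
  have sv: "singular_value W0 = \<sigma>" by (rule singular_value_eq[OF svd])
  have gap: "\<sigma> (r + 1) < \<sigma> r" if "r < CARD('n)" using assms(5)[OF that] by (simp add: sv)
  define Z0 where "Z0 = best_rank_approx r W0"
  have Z0: "Z0 = U ** diagonal_matrix (truncate_at r \<sigma>) ** adj V"
    unfolding Z0_def by (rule best_rank_approx_eq[OF svd assms(4) gap])
  \<comment> \<open>needed for the flow of \<open>Y\<close> to stay in the unitary orbit of its initial value\<close>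
  have skew_Z0: "adj Z0 = - Z0"
  proof -
    have "is_svd W0 (- V) \<sigma> U" using is_svd_minus_adj[OF svd] by (simp add: skew)
    from best_rank_approx_eq[OF this assms(4) gap]
    have "Z0 = (- V) ** diagonal_matrix (truncate_at r \<sigma>) ** adj U" by (simp add: Z0_def)
    also have "\<dots> = - adj Z0" by (simp add: Z0 adj_mult matrix_mul_assoc matrix_ring_simps)
    finally show ?thesis by (metis minus_equation_iff)
  qed
  define d where "d = sqrt (\<Sum>i = r + 1..CARD('n). (\<sigma> i)\<^sup>2)"
  have d: "norm (W0 - Z0) = d"
    using dist_truncated_svd[OF svd, of r] by (simp add: d_def Z0 real_sqrt_unique)
  obtain R where R: "\<And>s. s \<in> {0..T} \<Longrightarrow> R s \<in> unitary_group"
    and W: "\<And>s. s \<in> {0..T} \<Longrightarrow> W s = R s ** W0 ** adj (R s)" and R0: "R 0 = mat 1"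
    and R': "\<And>s Z0. s \<in> {0..T} \<Longrightarrow>
      ((\<lambda>t. R t ** Z0 ** adj (R t)) has_vector_derivative
        bracket (R s ** Z0 ** adj (R s)) (inverse_laplacian (W s))) (at s within {0..T})"
    using euler_zeitlin_unitary_conjugation[OF T assms(6) skew] by blast
  obtain S where S: "\<And>s. s \<in> {0..T} \<Longrightarrow> S s \<in> unitary_group"
    and Y: "\<And>s. s \<in> {0..T} \<Longrightarrow> Y s = S s ** Z0 ** adj (S s)"
    using euler_zeitlin_unitary_conjugation[OF T assms(7)] skew_Z0 unfolding Z0_def by metis
  define Z where "Z s = R s ** Z0 ** adj (R s)" for s
  have Z_best: "best_rank_approx r (W s) = Z s" if s: "s \<in> {0..T}" for s
  proof -
    have "is_svd (W s) (R s ** U) \<sigma> (R s ** V)"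
      using is_svd_unitary_mult[OF svd R[OF s] R[OF s]] by (simp add: W[OF s])
    from best_rank_approx_eq[OF this assms(4) gap] show ?thesis
      by (simp add: Z_def Z0 adj_mult matrix_mul_assoc)
  qed
  have norm_Z: "norm (Z s) = norm Z0" and norm_WZ: "norm (W s - Z s) = d" if s: "s \<in> {0..T}" for s
  proof -
    show "norm (Z s) = norm Z0" using R[OF s] by (simp add: Z_def)
    have "W s - Z s = R s ** (W0 - Z0) ** adj (R s)"
      by (simp add: W[OF s] Z_def matrix_ring_simps)
    then show "norm (W s - Z s) = d" using R[OF s] d by simp
  qed
  have orbit: "Y s \<in> coadjoint_orbit Z0" "Z s \<in> coadjoint_orbit Z0" if s: "s \<in> {0..T}" for s
    using S[OF s] R[OF s] by (auto simp: coadjoint_orbit_def Y[OF s] Z_def)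
  have "norm (Y t - Z t) \<le> (norm Z0 * d / h) / K * (exp (K * t) - 1)"
  proof (rule gronwall_norm[OF assms(8) _ _ _ _ t', where
        f' = "\<lambda>s. bracket (Y s) (inverse_laplacian (Y s)) - bracket (Z s) (inverse_laplacian (W s))"])
    show "0 \<le> norm Z0 * d / h" using hbar_nonneg[where 'n = 'n] by (simp add: d_def h_def sum_nonneg)
    show "Y 0 - Z 0 = 0"
      using assms(7) by (simp add: euler_zeitlin_solution_def Z_def R0 Z0_def)
    fix s assume s: "s \<in> {0..T}"
    show "((\<lambda>s. Y s - Z s) has_vector_derivative
        bracket (Y s) (inverse_laplacian (Y s)) - bracket (Z s) (inverse_laplacian (W s))) (at s within {0..T})"
      unfolding Z_def
      by (intro has_vector_derivative_diff euler_zeitlin_derivative[OF assms(7) s] R'[OF s])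
    \<comment> \<open>\<open>Z\<close> is driven by \<open>P (W)\<close> and not by \<open>P (Z)\<close>; what remains beside the difference of the
      field on the orbit is the effect of the discarded tail \<open>W - Z\<close>\<close>
    have "bracket (Y s) (inverse_laplacian (Y s)) - bracket (Z s) (inverse_laplacian (W s))
        = (hamiltonian_field (Y s) - hamiltonian_field (Z s))
          - bracket (Z s) (inverse_laplacian (W s - Z s))"
      by (simp add: hamiltonian_field_def inverse_laplacian_diff bracket_diff_right)
    then have "norm (bracket (Y s) (inverse_laplacian (Y s)) - bracket (Z s) (inverse_laplacian (W s)))
        \<le> norm (hamiltonian_field (Y s) - hamiltonian_field (Z s))
          + norm (bracket (Z s) (inverse_laplacian (W s - Z s)))"
      by (simp only: norm_triangle_ineq4)
    also have "\<dots> \<le> K * norm (Y s - Z s) + norm (Z s) * norm (W s - Z s) / h"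
      using lipschitz_onD[OF assms(9)[folded Z0_def] orbit[OF s]]
        norm_bracket_inverse_laplacian_le[of "Z s" "W s - Z s"]
      by (simp add: dist_norm h_def)
    finally show "norm (bracket (Y s) (inverse_laplacian (Y s)) - bracket (Z s) (inverse_laplacian (W s)))
        \<le> K * norm (Y s - Z s) + norm Z0 * d / h"
      by (simp add: norm_Z[OF s] norm_WZ[OF s])
  qed
  then show "norm (Y t - best_rank_approx r (W t))
      \<le> norm (best_rank_approx r W0) / (hbar CARD('n) * K) * (exp (K * t) - 1)
         * sqrt (\<Sum>i = r + 1..CARD('n). (singular_value W0 i)\<^sup>2)"
    unfolding Z_best[OF t'] sv Z0_def[symmetric] d_def[symmetric] h_def[symmetric]
    by (simp add: ac_simps)
qed

end
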